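(* There do not exist (non-trivial) biwarped product submanifolds of type $M_\bot\times_f M_T\times_\sigma M_\theta$ of a Kähler manifold $(\bar M,J,g)$ such that $M_\bot$ is a totally real, $M_T$ is a holomorphic and $M_\theta$ is a pointwise slant or slant submanifold of $\bar M$.
   Context: A Kähler manifold $(\bar M,J,g)$ is an almost complex manifold with Riemannian metric $g$ with $g(JX,JY)=g(X,Y)$ and $\bar\nabla J=0$, where $\bar\nabla$ is the Levi-Civita connection. A submanifold $N$ of $\bar M$ is pointwise slant if at each $p\in N$ the angle $\theta$ between $JV$ and $T_pN$ is independent of the nonzero vector $V\in T_pN$; the function $\theta$ on $N$ is the slant function. It is slant if $\theta$ is constant, holomorphic if $J(T_pN)\subseteq T_pN$ for all $p$, and totally real if $J(T_pN)\subseteq T_p^\bot N$ for all $p$. For Riemannian manifolds $(M_i,g_i)$, $i=0,1,2$, and smooth $f_1,f_2:M_0\to(0,\infty)$, the biwarped product $M_0\times_{f_1}M_1\times_{f_2}M_2$ is $M_0\times M_1\times M_2$ with metric $\pi_0^*g_0+(f_1\circ\pi_0)^2\pi_1^*g_1+(f_2\circ\pi_0)^2\pi_2^*g_2$, $\pi_i$ being the projections. It is called trivial if the warping functions $f_1$ and $f_2$ are constants. A biwarped product submanifold of $\bar M$ is an isometrically immersed submanifold of $\bar M$ that is a biwarped product with its induced metric.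
   Formalization: False as stated (e.g. R_+ × C ×_r S^1 in C^3): f is always shown constant, but σ only if J(TM_⊥) is normal to the whole submanifold, θ is one function on M_θ for all leaves, and θ is not identically π/2; M_⊥ is connected and all factors have positive dimension. *)

theory Defs
  imports "HOL-Analysis.Analysis"
begin

section \<open>Smooth maps between Euclidean spaces\<close>

primrec Ck_on :: "nat \<Rightarrow> ('e::euclidean_space \<Rightarrow> 'f::euclidean_space) \<Rightarrow> 'e set \<Rightarrow> bool" where
  "Ck_on 0 = (\<lambda>f S. continuous_on S f)"
| "Ck_on (Suc k) = (\<lambda>f S. (\<forall>x\<in>S. f differentiable (at x)) \<and>
     (\<forall>v. Ck_on k (\<lambda>x. frechet_derivative f (at x) v) S))"

text \<open>Only used for open \<open>S\<close>.\<close>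

definition smooth_on :: "('e::euclidean_space \<Rightarrow> 'f::euclidean_space) \<Rightarrow> 'e set \<Rightarrow> bool" where
  "smooth_on f S \<longleftrightarrow> (\<forall>k. Ck_on k f S)"


section \<open>Smooth manifolds\<close>

text \<open>
  A chart is a pair \<open>(U, \<phi>)\<close> of a domain and a coordinate map; the values of \<open>\<phi>\<close> outside \<open>U\<close>
  are irrelevant. The model space is an arbitrary Euclidean space, so all manifolds have
  positive dimension.
\<close>

type_synonym ('a, 'e) chart = "'a set \<times> ('a \<Rightarrow> 'e)"

record ('a, 'e) mfd =
  mtop :: "'a topology"
  atlas :: "('a, 'e) chart set"

abbreviation points :: "('a, 'e) mfd \<Rightarrow> 'a set" where
  "points M \<equiv> topspace (mtop M)"

abbreviation cdom :: "('a, 'e) chart \<Rightarrow> 'a set" where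
  "cdom \<equiv> fst"

abbreviation cmap :: "('a, 'e) chart \<Rightarrow> 'a \<Rightarrow> 'e" where
  "cmap \<equiv> snd"

definition cinv :: "('a, 'e) chart \<Rightarrow> 'e \<Rightarrow> 'a" where
  "cinv c = inv_into (cdom c) (cmap c)"

definition charts_at :: "('a, 'e) mfd \<Rightarrow> 'a \<Rightarrow> ('a, 'e) chart set" where
  "charts_at M p = {c \<in> atlas M. p \<in> cdom c}"

definition some_chart :: "('a, 'e) mfd \<Rightarrow> 'a \<Rightarrow> ('a, 'e) chart" where
  "some_chart M p = (SOME c. c \<in> charts_at M p)"

definition smooth_manifold :: "('a, 'e::euclidean_space) mfd \<Rightarrow> bool" where
  "smooth_manifold M \<longleftrightarrow>
     points M \<noteq> {} \<and> Hausdorff_space (mtop M) \<and> second_countable (mtop M) \<and>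
     points M = (\<Union>c\<in>atlas M. cdom c) \<and>
     (\<forall>c\<in>atlas M. openin (mtop M) (cdom c) \<and> open (cmap c ` cdom c) \<and>
        homeomorphic_map (subtopology (mtop M) (cdom c)) (top_of_set (cmap c ` cdom c)) (cmap c)) \<and>
     (\<forall>c\<in>atlas M. \<forall>d\<in>atlas M. smooth_on (cmap d \<circ> cinv c) (cmap c ` (cdom c \<inter> cdom d)))"

definition smooth_fun_on ::
  "('a, 'e::euclidean_space) mfd \<Rightarrow> ('a \<Rightarrow> real) \<Rightarrow> 'a set \<Rightarrow> bool" where
  "smooth_fun_on M h U \<longleftrightarrow>
     (\<forall>c\<in>atlas M. smooth_on (h \<circ> cinv c) (cmap c ` (U \<inter> cdom c)))"

definition smooth_map ::
  "('a, 'e::euclidean_space) mfd \<Rightarrow> ('b, 'f::euclidean_space) mfd \<Rightarrow> ('a \<Rightarrow> 'b) \<Rightarrow> bool" where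
  "smooth_map M N F \<longleftrightarrow> continuous_map (mtop M) (mtop N) F \<and>
     (\<forall>c\<in>atlas M. \<forall>d\<in>atlas N.
        smooth_on (cmap d \<circ> F \<circ> cinv c) (cmap c ` {p \<in> cdom c. F p \<in> cdom d}))"

definition prod_mfd :: "('a, 'e) mfd \<Rightarrow> ('b, 'f) mfd \<Rightarrow> ('a \<times> 'b, 'e \<times> 'f) mfd" where
  "prod_mfd M N =
     \<lparr>mtop = prod_topology (mtop M) (mtop N),
      atlas = {(cdom c \<times> cdom d, map_prod (cmap c) (cmap d)) | c d. c \<in> atlas M \<and> d \<in> atlas N}\<rparr>"


section \<open>Tangent vectors\<close>

text \<open>
  A tangent vector at \<open>p\<close> is given by its coordinates in all charts around \<open>p\<close>, subject to the
  transformation law; it is zero at the charts not around \<open>p\<close>. Equivalently it is a class of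
  pairs (chart, coordinate vector). The zero vector is \<open>\<lambda>_. 0\<close>.
\<close>

type_synonym ('a, 'e) tvec = "('a, 'e) chart \<Rightarrow> 'e"

definition tangent :: "('a, 'e::euclidean_space) mfd \<Rightarrow> 'a \<Rightarrow> ('a, 'e) tvec set" where
  "tangent M p =
     {v. (\<forall>c\<in>charts_at M p. \<forall>d\<in>charts_at M p.
            v d = frechet_derivative (cmap d \<circ> cinv c) (at (cmap c p)) (v c)) \<and>
         (\<forall>c. c \<notin> charts_at M p \<longrightarrow> v c = 0)}"

definition lincomb ::
  "real \<Rightarrow> ('a, 'e::euclidean_space) tvec \<Rightarrow> real \<Rightarrow> ('a, 'e) tvec \<Rightarrow> ('a, 'e) tvec" where
  "lincomb a v b w = (\<lambda>c. a *\<^sub>R v c + b *\<^sub>R w c)"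

text \<open>
  On smooth maps, resp. smooth functions, and tangent vectors, the following two do not depend
  on the choice of the chart around \<open>p\<close>.
\<close>

definition diff_map ::
  "('a, 'e::euclidean_space) mfd \<Rightarrow> ('b, 'f::euclidean_space) mfd \<Rightarrow> ('a \<Rightarrow> 'b) \<Rightarrow>
   'a \<Rightarrow> ('a, 'e) tvec \<Rightarrow> ('b, 'f) tvec" where
  "diff_map M N F p v =
     (let c = some_chart M p in
      (\<lambda>d. if d \<in> charts_at N (F p)
           then frechet_derivative (cmap d \<circ> F \<circ> cinv c) (at (cmap c p)) (v c) else 0))"

definition dir_deriv ::
  "('a, 'e::euclidean_space) mfd \<Rightarrow> 'a \<Rightarrow> ('a, 'e) tvec \<Rightarrow> ('a \<Rightarrow> real) \<Rightarrow> real" where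
  "dir_deriv M p v h =
     (let c = some_chart M p in frechet_derivative (h \<circ> cinv c) (at (cmap c p)) (v c))"


section \<open>Vector fields, metrics and connections\<close>

type_synonym ('a, 'e) vfield = "'a \<Rightarrow> ('a, 'e) tvec"

definition smooth_vfield_on ::
  "('a, 'e::euclidean_space) mfd \<Rightarrow> ('a, 'e) vfield \<Rightarrow> 'a set \<Rightarrow> bool" where
  "smooth_vfield_on M X U \<longleftrightarrow> openin (mtop M) U \<and> (\<forall>p\<in>U. X p \<in> tangent M p) \<and>
     (\<forall>c\<in>atlas M. smooth_on (\<lambda>x. X (cinv c x) c) (cmap c ` (U \<inter> cdom c)))"

definition lie_bracket ::
  "('a, 'e::euclidean_space) mfd \<Rightarrow> ('a, 'e) vfield \<Rightarrow> ('a, 'e) vfield \<Rightarrow> ('a, 'e) vfield" where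
  "lie_bracket M X Y p = (\<lambda>c. if c \<in> charts_at M p
     then frechet_derivative (\<lambda>x. Y (cinv c x) c) (at (cmap c p)) (X p c)
        - frechet_derivative (\<lambda>x. X (cinv c x) c) (at (cmap c p)) (Y p c)
     else 0)"

type_synonym ('a, 'e) metric = "'a \<Rightarrow> ('a, 'e) tvec \<Rightarrow> ('a, 'e) tvec \<Rightarrow> real"

definition riemannian_metric ::
  "('a, 'e::euclidean_space) mfd \<Rightarrow> ('a, 'e) metric \<Rightarrow> bool" where
  "riemannian_metric M g \<longleftrightarrow>
     (\<forall>p\<in>points M. \<forall>u\<in>tangent M p. \<forall>v\<in>tangent M p.
        g p u v = g p v u \<and> (u \<noteq> (\<lambda>_. 0) \<longrightarrow> g p u u > 0) \<and>
        (\<forall>w\<in>tangent M p. \<forall>a b. g p (lincomb a u b v) w = a * g p u w + b * g p v w)) \<and>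
     (\<forall>U X Y. smooth_vfield_on M X U \<and> smooth_vfield_on M Y U \<longrightarrow>
        smooth_fun_on M (\<lambda>p. g p (X p) (Y p)) U)"

definition riemannian_manifold ::
  "('a, 'e::euclidean_space) mfd \<Rightarrow> ('a, 'e) metric \<Rightarrow> bool" where
  "riemannian_manifold M g \<longleftrightarrow> smooth_manifold M \<and> riemannian_metric M g"

text \<open>
  \<open>D p v Y\<close> is the covariant derivative at \<open>p\<close>, in the direction of the tangent vector \<open>v\<close>, of a
  vector field \<open>Y\<close> that is smooth on some open neighbourhood of \<open>p\<close>.
\<close>

type_synonym ('a, 'e) connection = "'a \<Rightarrow> ('a, 'e) tvec \<Rightarrow> ('a, 'e) vfield \<Rightarrow> ('a, 'e) tvec"

definition affine_connection ::
  "('a, 'e::euclidean_space) mfd \<Rightarrow> ('a, 'e) connection \<Rightarrow> bool" where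
  "affine_connection M D \<longleftrightarrow>
     (\<forall>U Y. smooth_vfield_on M Y U \<longrightarrow>
        (\<forall>p\<in>U. \<forall>v\<in>tangent M p.
           D p v Y \<in> tangent M p \<and>
           (\<forall>w\<in>tangent M p. \<forall>a b. D p (lincomb a v b w) Y = lincomb a (D p v Y) b (D p w Y)) \<and>
           (\<forall>Z. smooth_vfield_on M Z U \<longrightarrow>
              D p v (\<lambda>q. lincomb 1 (Y q) 1 (Z q)) = lincomb 1 (D p v Y) 1 (D p v Z)) \<and>
           (\<forall>h. smooth_fun_on M h U \<longrightarrow>
              D p v (\<lambda>q. lincomb (h q) (Y q) 0 (Y q)) =
                lincomb (dir_deriv M p v h) (Y p) (h p) (D p v Y)) \<and>
           (\<forall>Z. (\<forall>q\<in>U. Z q = Y q) \<longrightarrow> D p v Z = D p v Y)) \<and>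
        (\<forall>X. smooth_vfield_on M X U \<longrightarrow> smooth_vfield_on M (\<lambda>p. D p (X p) Y) U))"

definition torsion_free ::
  "('a, 'e::euclidean_space) mfd \<Rightarrow> ('a, 'e) connection \<Rightarrow> bool" where
  "torsion_free M D \<longleftrightarrow>
     (\<forall>U X Y. smooth_vfield_on M X U \<and> smooth_vfield_on M Y U \<longrightarrow>
        (\<forall>p\<in>U. lincomb 1 (D p (X p) Y) (-1) (D p (Y p) X) = lie_bracket M X Y p))"

definition metric_connection ::
  "('a, 'e::euclidean_space) mfd \<Rightarrow> ('a, 'e) metric \<Rightarrow> ('a, 'e) connection \<Rightarrow> bool" where
  "metric_connection M g D \<longleftrightarrow>
     (\<forall>U Y Z. smooth_vfield_on M Y U \<and> smooth_vfield_on M Z U \<longrightarrow>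
        (\<forall>p\<in>U. \<forall>v\<in>tangent M p.
           dir_deriv M p v (\<lambda>q. g q (Y q) (Z q)) = g p (D p v Y) (Z p) + g p (Y p) (D p v Z)))"

definition levi_civita ::
  "('a, 'e::euclidean_space) mfd \<Rightarrow> ('a, 'e) metric \<Rightarrow> ('a, 'e) connection \<Rightarrow> bool" where
  "levi_civita M g D \<longleftrightarrow> affine_connection M D \<and> torsion_free M D \<and> metric_connection M g D"


section \<open>Kaehler manifolds\<close>

type_synonym ('a, 'e) endo = "'a \<Rightarrow> ('a, 'e) tvec \<Rightarrow> ('a, 'e) tvec"

definition almost_complex_structure ::
  "('a, 'e::euclidean_space) mfd \<Rightarrow> ('a, 'e) endo \<Rightarrow> bool" where
  "almost_complex_structure M J \<longleftrightarrow>
     (\<forall>p\<in>points M. \<forall>v\<in>tangent M p.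
        J p v \<in> tangent M p \<and> J p (J p v) = (\<lambda>c. - v c) \<and>
        (\<forall>w\<in>tangent M p. \<forall>a b. J p (lincomb a v b w) = lincomb a (J p v) b (J p w))) \<and>
     (\<forall>U X. smooth_vfield_on M X U \<longrightarrow> smooth_vfield_on M (\<lambda>p. J p (X p)) U)"

definition parallel_endo ::
  "('a, 'e::euclidean_space) mfd \<Rightarrow> ('a, 'e) connection \<Rightarrow> ('a, 'e) endo \<Rightarrow> bool" where
  "parallel_endo M D J \<longleftrightarrow>
     (\<forall>U Y. smooth_vfield_on M Y U \<longrightarrow>
        (\<forall>p\<in>U. \<forall>v\<in>tangent M p. D p v (\<lambda>q. J q (Y q)) = J p (D p v Y)))"

text \<open>
  The Levi-Civita connection exists and is unique on locally defined smooth vector fields, so the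
  existential quantifier merely names it.
\<close>

definition kaehler_manifold ::
  "('a, 'e::euclidean_space) mfd \<Rightarrow> ('a, 'e) endo \<Rightarrow> ('a, 'e) metric \<Rightarrow> bool" where
  "kaehler_manifold M J g \<longleftrightarrow>
     riemannian_manifold M g \<and> almost_complex_structure M J \<and>
     (\<forall>p\<in>points M. \<forall>v\<in>tangent M p. \<forall>w\<in>tangent M p. g p (J p v) (J p w) = g p v w) \<and>
     (\<exists>D. levi_civita M g D \<and> parallel_endo M D J)"


section \<open>Immersed submanifolds\<close>

definition pullback_metric ::
  "('a, 'e::euclidean_space) mfd \<Rightarrow> ('b, 'f::euclidean_space) mfd \<Rightarrow> ('a \<Rightarrow> 'b) \<Rightarrow>
   ('b, 'f) metric \<Rightarrow> ('a, 'e) metric" where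
  "pullback_metric M N F h p v w = h (F p) (diff_map M N F p v) (diff_map M N F p w)"

definition immersion ::
  "('a, 'e::euclidean_space) mfd \<Rightarrow> ('b, 'f::euclidean_space) mfd \<Rightarrow> ('a \<Rightarrow> 'b) \<Rightarrow> bool" where
  "immersion M N F \<longleftrightarrow> smooth_map M N F \<and>
     (\<forall>p\<in>points M. inj_on (diff_map M N F p) (tangent M p))"

definition isometric_immersion ::
  "('a, 'e::euclidean_space) mfd \<Rightarrow> ('a, 'e) metric \<Rightarrow>
   ('b, 'f::euclidean_space) mfd \<Rightarrow> ('b, 'f) metric \<Rightarrow> ('a \<Rightarrow> 'b) \<Rightarrow> bool" where
  "isometric_immersion M g N h F \<longleftrightarrow> immersion M N F \<and>
     (\<forall>p\<in>points M. \<forall>v\<in>tangent M p. \<forall>w\<in>tangent M p. pullback_metric M N F h p v w = g p v w)"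

text \<open>
  In the following, \<open>N\<close> is regarded as a submanifold of \<open>M\<close> through the immersion \<open>F\<close>, i.e. the
  tangent space of the submanifold at \<open>p\<close> is \<open>diff_map N M F p ` tangent N p\<close>.
\<close>

definition totally_real ::
  "('a, 'e::euclidean_space) mfd \<Rightarrow> ('a, 'e) endo \<Rightarrow> ('a, 'e) metric \<Rightarrow>
   ('b, 'f::euclidean_space) mfd \<Rightarrow> ('b \<Rightarrow> 'a) \<Rightarrow> bool" where
  "totally_real M J g N F \<longleftrightarrow>
     (\<forall>p\<in>points N. \<forall>v\<in>tangent N p. \<forall>w\<in>tangent N p.
        g (F p) (J (F p) (diff_map N M F p v)) (diff_map N M F p w) = 0)"

definition holomorphic_submfd ::
  "('a, 'e::euclidean_space) mfd \<Rightarrow> ('a, 'e) endo \<Rightarrow>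
   ('b, 'f::euclidean_space) mfd \<Rightarrow> ('b \<Rightarrow> 'a) \<Rightarrow> bool" where
  "holomorphic_submfd M J N F \<longleftrightarrow>
     (\<forall>p\<in>points N. J (F p) ` diff_map N M F p ` tangent N p \<subseteq> diff_map N M F p ` tangent N p)"

text \<open>The angle between a nonzero vector and a subspace: the infimum is attained and lies in
  \<open>[0, pi/2]\<close>.\<close>

definition angle_to ::
  "('a, 'e::euclidean_space) metric \<Rightarrow> 'a \<Rightarrow> ('a, 'e) tvec \<Rightarrow> ('a, 'e) tvec set \<Rightarrow> real" where
  "angle_to g p u S =
     (INF w\<in>S - {\<lambda>_. 0}. arccos (g p u w / (sqrt (g p u u) * sqrt (g p w w))))"

definition is_slant_function ::
  "('a, 'e::euclidean_space) mfd \<Rightarrow> ('a, 'e) endo \<Rightarrow> ('a, 'e) metric \<Rightarrow>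
   ('b, 'f::euclidean_space) mfd \<Rightarrow> ('b \<Rightarrow> 'a) \<Rightarrow> ('b \<Rightarrow> real) \<Rightarrow> bool" where
  "is_slant_function M J g N F \<theta> \<longleftrightarrow>
     (\<forall>p\<in>points N. \<forall>v\<in>tangent N p - {\<lambda>_. 0}.
        angle_to g (F p) (J (F p) (diff_map N M F p v)) (diff_map N M F p ` tangent N p) = \<theta> p)"

definition pointwise_slant ::
  "('a, 'e::euclidean_space) mfd \<Rightarrow> ('a, 'e) endo \<Rightarrow> ('a, 'e) metric \<Rightarrow>
   ('b, 'f::euclidean_space) mfd \<Rightarrow> ('b \<Rightarrow> 'a) \<Rightarrow> bool" where
  "pointwise_slant M J g N F \<longleftrightarrow> (\<exists>\<theta>. is_slant_function M J g N F \<theta>)"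

definition slant ::
  "('a, 'e::euclidean_space) mfd \<Rightarrow> ('a, 'e) endo \<Rightarrow> ('a, 'e) metric \<Rightarrow>
   ('b, 'f::euclidean_space) mfd \<Rightarrow> ('b \<Rightarrow> 'a) \<Rightarrow> bool" where
  "slant M J g N F \<longleftrightarrow> (\<exists>\<theta>. is_slant_function M J g N F (\<lambda>_. \<theta>))"


section \<open>Biwarped products\<close>

definition warping_function :: "('a, 'e::euclidean_space) mfd \<Rightarrow> ('a \<Rightarrow> real) \<Rightarrow> bool" where
  "warping_function M f \<longleftrightarrow> smooth_fun_on M f (points M) \<and> (\<forall>p\<in>points M. f p > 0)"

abbreviation prod3 ::
  "('a, 'e) mfd \<Rightarrow> ('b, 'f) mfd \<Rightarrow> ('c, 'h) mfd \<Rightarrow> ('a \<times> 'b \<times> 'c, 'e \<times> 'f \<times> 'h) mfd" where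
  "prod3 M0 M1 M2 \<equiv> prod_mfd M0 (prod_mfd M1 M2)"

definition biwarped_metric ::
  "('a, 'e::euclidean_space) mfd \<Rightarrow> ('a, 'e) metric \<Rightarrow> ('a \<Rightarrow> real) \<Rightarrow>
   ('b, 'f::euclidean_space) mfd \<Rightarrow> ('b, 'f) metric \<Rightarrow> ('a \<Rightarrow> real) \<Rightarrow>
   ('c, 'h::euclidean_space) mfd \<Rightarrow> ('c, 'h) metric \<Rightarrow>
   ('a \<times> 'b \<times> 'c, 'e \<times> 'f \<times> 'h) metric" where
  "biwarped_metric M0 g0 f1 M1 g1 f2 M2 g2 p v w =
     pullback_metric (prod3 M0 M1 M2) M0 fst g0 p v w
     + (f1 (fst p))\<^sup>2 * pullback_metric (prod3 M0 M1 M2) M1 (fst \<circ> snd) g1 p v w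
     + (f2 (fst p))\<^sup>2 * pullback_metric (prod3 M0 M1 M2) M2 (snd \<circ> snd) g2 p v w"

definition trivial_biwarped :: "('a, 'e) mfd \<Rightarrow> ('a \<Rightarrow> real) \<Rightarrow> ('a \<Rightarrow> real) \<Rightarrow> bool" where
  "trivial_biwarped M0 f1 f2 \<longleftrightarrow> f1 constant_on points M0 \<and> f2 constant_on points M0"

text \<open>\<open>F\<close> realises \<open>M\<^sub>0 \<times>\<^bsub>f1\<^esub> M\<^sub>1 \<times>\<^bsub>f2\<^esub> M\<^sub>2\<close> as an isometrically immersed submanifold of \<open>(M, g)\<close>.\<close>

definition biwarped_submanifold ::
  "('m, 'k::euclidean_space) mfd \<Rightarrow> ('m, 'k) metric \<Rightarrow>
   ('a, 'e::euclidean_space) mfd \<Rightarrow> ('a, 'e) metric \<Rightarrow> ('a \<Rightarrow> real) \<Rightarrow>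
   ('b, 'f::euclidean_space) mfd \<Rightarrow> ('b, 'f) metric \<Rightarrow> ('a \<Rightarrow> real) \<Rightarrow>
   ('c, 'h::euclidean_space) mfd \<Rightarrow> ('c, 'h) metric \<Rightarrow> ('a \<times> 'b \<times> 'c \<Rightarrow> 'm) \<Rightarrow> bool" where
  "biwarped_submanifold M g M0 g0 f1 M1 g1 f2 M2 g2 F \<longleftrightarrow>
     riemannian_manifold M0 g0 \<and> riemannian_manifold M1 g1 \<and> riemannian_manifold M2 g2 \<and>
     warping_function M0 f1 \<and> warping_function M0 f2 \<and>
     isometric_immersion (prod3 M0 M1 M2) (biwarped_metric M0 g0 f1 M1 g1 f2 M2 g2) M g F"

text \<open>
  The factor \<open>M0\<close> is a submanifold of \<open>M\<close> through the leaves \<open>\<lambda>x. F (x, y, z)\<close>. The next condition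
  says that \<open>J\<close> maps their tangent vectors to normal vectors of the whole submanifold \<open>F\<close>; total
  reality of the leaves alone only says that the images are normal to the leaf itself.
\<close>

definition base_J_normal ::
  "('m, 'k::euclidean_space) mfd \<Rightarrow> ('m, 'k) endo \<Rightarrow> ('m, 'k) metric \<Rightarrow>
   ('a, 'e::euclidean_space) mfd \<Rightarrow> ('b, 'f::euclidean_space) mfd \<Rightarrow>
   ('c, 'h::euclidean_space) mfd \<Rightarrow> ('a \<times> 'b \<times> 'c \<Rightarrow> 'm) \<Rightarrow> bool" where
  "base_J_normal M J g M0 M1 M2 F \<longleftrightarrow>
     (\<forall>x\<in>points M0. \<forall>y\<in>points M1. \<forall>z\<in>points M2.
        \<forall>u\<in>tangent M0 x. \<forall>w\<in>tangent (prod3 M0 M1 M2) (x, y, z).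
          g (F (x, y, z)) (J (F (x, y, z)) (diff_map M0 M (\<lambda>x'. F (x', y, z)) x u))
            (diff_map (prod3 M0 M1 M2) M F (x, y, z) w) = 0)"

end

theory Submission
  imports Defs
begin

text \<open>
  The Kaehler form \<open>\<omega>(u, v) = g(Ju, v)\<close> is closed, hence so is its pullback to the biwarped product.
  If \<open>\<omega>(Z, V) = 0\<close> for all \<open>Z\<close> tangent to the base and all \<open>V\<close> tangent to one of the fibres, then
  \<open>d\<omega>(Z, V, W) = 0\<close> reduces to \<open>Z(\<omega>(V, W)) = 0\<close> for vectors \<open>V\<close>, \<open>W\<close> lifted from that fibre, so
  \<open>\<omega>(V, W)\<close> does not depend on the base point. For the holomorphic fibre the orthogonality is
  automatic because \<open>JV\<close> is again tangent to the fibre, and the norm of \<open>\<omega>\<close> with respect to \<open>g\<^sub>1\<close>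
  is \<open>f\<^sup>2\<close>, whence \<open>f\<close> is constant. For the slant fibre the supremum of \<open>\<omega>(V, W)\<close> over unit vectors
  \<open>W\<close> for \<open>g\<^sub>2\<close>, with \<open>V\<close> a fixed unit vector, is \<open>\<sigma>\<^sup>2 cos \<theta>\<close>; as \<open>\<theta>\<close> only depends on the fibre point
  and \<open>cos \<theta> \<noteq> 0\<close> somewhere, \<open>\<sigma>\<close> is constant.
\<close>

section \<open>Calculus of smooth maps\<close>

text \<open>Working with \<open>\<omega>\<close> needs neither the second fundamental form of
  \<open>F\<close> nor the Levi-Civita connection of the warped metric: only \<open>F\<close> and
  its first derivatives enter the statements, and closedness passes to the pullback by the symmetry
  of second derivatives. No bracket terms appear because all fields are constant-coefficient fields
  of a product chart. A vanishing derivative gives constancy only locally; connectedness of the base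
  makes it global. The obstacle in the holomorphic case is that the endomorphism which
  \<open>J\<close> induces on a fixed tangent space of the fibre may vary with the base point. Hence
  \<open>\<omega>(V, JV)\<close> cannot simply be evaluated at two base points, and \<open>f\<close>
  is compared by an inequality that is symmetric in them. In the slant case \<open>J\<close> leaves
  the tangent space of the fibre, so orthogonality to the base is not automatic and comes from
  \<open>base_J_normal\<close>; the angle is an infimum, so the comparison is one of least upper
  bounds.\<close>

abbreviation fd :: "('e::real_normed_vector \<Rightarrow> 'f::real_normed_vector) \<Rightarrow> 'e \<Rightarrow> 'e \<Rightarrow> 'f" where
  "fd f x \<equiv> frechet_derivative f (at x)"

lemma fd_eqI: "(f has_derivative f') (at x) \<Longrightarrow> fd f x = f'"
  by (metis frechet_derivative_at)

lemma has_derivative_fd: "f differentiable (at x) \<Longrightarrow> (f has_derivative fd f x) (at x)"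
  by (simp add: frechet_derivative_works)

lemma has_derivative_fd_compose:
  assumes "(G has_derivative G') (at s)" "f differentiable (at (G s))"
  shows "((\<lambda>s. f (G s)) has_derivative (\<lambda>r. fd f (G s) (G' r))) (at s)"
  by (rule has_derivative_compose[OF assms(1) has_derivative_fd[OF assms(2)]])

lemma fd_cong_open:
  assumes "f differentiable (at x)" "open S" "x \<in> S" "\<And>y. y \<in> S \<Longrightarrow> f y = g y"
  shows "g differentiable (at x)" and "fd g x = fd f x"
proof -
  have "(g has_derivative fd f x) (at x)"
    using has_derivative_transform_within_open[OF has_derivative_fd[OF assms(1)] assms(2,3)] assms(4)
    by blast
  then show "g differentiable (at x)" "fd g x = fd f x"
    by (auto simp: differentiable_def fd_eqI)
qed

text \<open>\<open>Ck_on\<close> takes derivatives in the full space, so agreement on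
  \<open>S\<close> controls them only because \<open>S\<close> is open; the induction then passes to
  the directional derivatives, which again agree on \<open>S\<close>.\<close>

lemma Ck_on_cong:
  assumes "open S"
  shows "Ck_on k f S \<Longrightarrow> (\<And>x. x \<in> S \<Longrightarrow> f x = g x) \<Longrightarrow> Ck_on k g S"
proof (induction k arbitrary: f g)
  case 0
  then show ?case by (simp cong: continuous_on_cong)
next
  case (Suc k)
  have d: "f differentiable (at x)" if "x \<in> S" for x
    using Suc.prems(1) that by simp
  have "g differentiable (at x)" and *: "fd g x = fd f x" if "x \<in> S" for x
    using fd_cong_open[OF d[OF that] assms that] Suc.prems(2) by blast+
  moreover have "Ck_on k (\<lambda>x. fd g x v) S" for v
    using Suc.IH[of "\<lambda>x. fd f x v" "\<lambda>x. fd g x v"] Suc.prems(1) * by simp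
  ultimately show ?case by simp
qed

lemma Ck_on_SucD: "Ck_on (Suc k) f S \<Longrightarrow> Ck_on k f S"
proof (induction k arbitrary: f)
  case 0
  then show ?case
    by (auto intro!: differentiable_imp_continuous_on differentiable_at_imp_differentiable_on)
next
  case (Suc k)
  then show ?case by simp
qed

lemma Ck_on_const: "Ck_on k (\<lambda>x. c) S"
proof (induction k arbitrary: c)
  case (Suc k)
  have "fd (\<lambda>x. c) x v = 0" for x v :: 'a by (simp add: fd_eqI)
  with Suc show ?case by simp
qed simp

lemma Ck_on_add:
  assumes "open S"
  shows "Ck_on k f S \<Longrightarrow> Ck_on k g S \<Longrightarrow> Ck_on k (\<lambda>x. f x + g x) S"
proof (induction k arbitrary: f g)
  case (Suc k)
  have d: "((\<lambda>x. f x + g x) has_derivative (\<lambda>v. fd f x v + fd g x v)) (at x)" if "x \<in> S" for x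
    using Suc.prems that by (intro has_derivative_add has_derivative_fd) auto
  have "Ck_on k (\<lambda>x. fd (\<lambda>x. f x + g x) x v) S" for v
    by (rule Ck_on_cong[OF assms Suc.IH[of "\<lambda>x. fd f x v" "\<lambda>x. fd g x v"]])
      (use Suc.prems fd_eqI[OF d] in auto)
  then show ?case using d by (auto simp: differentiable_def)
qed (auto intro: continuous_intros)

lemma Ck_on_sum:
  assumes "open S" "\<And>i. i \<in> I \<Longrightarrow> Ck_on k (f i) S"
  shows "Ck_on k (\<lambda>x. \<Sum>i\<in>I. f i x) S"
  using assms(2)
  by (induction I rule: infinite_finite_induct) (auto intro: Ck_on_const Ck_on_add[OF assms(1)])

lemma Ck_on_scaleR:
  assumes "open S"
  shows "Ck_on k a S \<Longrightarrow> Ck_on k f S \<Longrightarrow> Ck_on k (\<lambda>x. a x *\<^sub>R f x) S"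
proof (induction k arbitrary: a f)
  case (Suc k)
  have d: "((\<lambda>x. a x *\<^sub>R f x) has_derivative (\<lambda>v. a x *\<^sub>R fd f x v + fd a x v *\<^sub>R f x)) (at x)"
    if "x \<in> S" for x
    using Suc.prems that by (intro has_derivative_scaleR has_derivative_fd) auto
  have "Ck_on k (\<lambda>x. fd (\<lambda>x. a x *\<^sub>R f x) x v) S" for v
    by (rule Ck_on_cong[OF assms, of _ "\<lambda>x. a x *\<^sub>R fd f x v + fd a x v *\<^sub>R f x"])
      (use Suc Ck_on_SucD[OF Suc.prems(1)] Ck_on_SucD[OF Suc.prems(2)] fd_eqI[OF d]
        in \<open>auto intro!: Ck_on_add[OF assms]\<close>)
  then show ?case using d by (auto simp: differentiable_def)
qed (auto intro: continuous_intros)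

lemma Ck_on_bounded_linear:
  assumes "bounded_linear L" "open S"
  shows "Ck_on k f S \<Longrightarrow> Ck_on k (\<lambda>x. L (f x)) S"
proof (induction k arbitrary: f)
  case 0
  then show ?case using bounded_linear.continuous_on[OF assms(1)] by simp
next
  case (Suc k)
  have d: "((\<lambda>x. L (f x)) has_derivative (\<lambda>v. L (fd f x v))) (at x)" if "x \<in> S" for x
    using Suc.prems that
    by (intro bounded_linear.has_derivative[OF assms(1)] has_derivative_fd) auto
  have "Ck_on k (\<lambda>x. fd (\<lambda>x. L (f x)) x v) S" for v
    by (rule Ck_on_cong[OF assms(2) Suc.IH[of "\<lambda>x. fd f x v"]])
      (use Suc.prems fd_eqI[OF d] in auto)
  then show ?case using d by (auto simp: differentiable_def)
qed

lemma linear_basis_expansion: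
  fixes L :: "'a::euclidean_space \<Rightarrow> 'b::real_vector"
  assumes "linear L"
  shows "L v = (\<Sum>b\<in>Basis. (v \<bullet> b) *\<^sub>R L b)"
proof -
  have "L v = L (\<Sum>b\<in>Basis. (v \<bullet> b) *\<^sub>R b)" by (simp add: euclidean_representation)
  also have "\<dots> = (\<Sum>b\<in>Basis. (v \<bullet> b) *\<^sub>R L b)"
    by (simp add: linear_sum[OF assms] linear_cmul[OF assms])
  finally show ?thesis .
qed

lemma fd_linear: "f differentiable (at x) \<Longrightarrow> linear (fd f x)"
  using has_derivative_fd has_derivative_linear by blast

text \<open>The chain rule applies \<open>fd f (g x)\<close> to a vector that moves with
  \<open>x\<close>. Expanding this vector in the basis leaves scalar coefficients times the maps
  \<open>fd f (g x) b\<close> with \<open>b\<close> fixed, to which the induction hypothesis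
  applies.\<close>

lemma Ck_on_compose:
  assumes "open S" "open T" "g ` S \<subseteq> T"
  shows "Ck_on k f T \<Longrightarrow> Ck_on k g S \<Longrightarrow> Ck_on k (\<lambda>x. f (g x)) S"
proof (induction k arbitrary: f)
  case 0
  then show ?case using assms(3) by (auto intro: continuous_on_compose2)
next
  case (Suc k)
  have df: "f differentiable (at (g x))" if "x \<in> S" for x
    using Suc.prems(1) that assms(3) by auto
  have dg: "g differentiable (at x)" if "x \<in> S" for x
    using Suc.prems(2) that by auto
  have d: "((\<lambda>x. f (g x)) has_derivative (\<lambda>v. fd f (g x) (fd g x v))) (at x)" if "x \<in> S" for x
    by (rule has_derivative_compose[OF has_derivative_fd[OF dg[OF that]]
          has_derivative_fd[OF df[OF that]]])
  have "Ck_on k (\<lambda>x. fd (\<lambda>x. f (g x)) x v) S" for v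
  proof (rule Ck_on_cong[OF assms(1)])
    show "Ck_on k (\<lambda>x. \<Sum>b\<in>Basis. (fd g x v \<bullet> b) *\<^sub>R fd f (g x) b) S"
      using Suc.IH[of "\<lambda>x. fd f x _"] Suc.prems Ck_on_SucD[OF Suc.prems(2)]
      by (intro Ck_on_sum[OF assms(1)] Ck_on_scaleR[OF assms(1)]
          Ck_on_bounded_linear[OF bounded_linear_inner_left assms(1)]) auto
    show "(\<Sum>b\<in>Basis. (fd g x v \<bullet> b) *\<^sub>R fd f (g x) b) = fd (\<lambda>x. f (g x)) x v" if "x \<in> S" for x
      using linear_basis_expansion[OF fd_linear[OF df[OF that]], of "fd g x v"] fd_eqI[OF d[OF that]]
      by simp
  qed
  then show ?case using d by (auto simp: differentiable_def)
qed

lemma smooth_on_compose: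
  assumes "open S" "open T" "g ` S \<subseteq> T" "smooth_on f T" "smooth_on g S"
  shows "smooth_on (\<lambda>x. f (g x)) S"
  using Ck_on_compose[OF assms(1-3)] assms(4,5) unfolding smooth_on_def by blast

lemma smooth_on_cong:
  "open S \<Longrightarrow> smooth_on f S \<Longrightarrow> (\<And>x. x \<in> S \<Longrightarrow> f x = g x) \<Longrightarrow> smooth_on g S"
  unfolding smooth_on_def using Ck_on_cong by blast

lemma smooth_on_fd: "smooth_on f S \<Longrightarrow> smooth_on (\<lambda>x. fd f x v) S"
  unfolding smooth_on_def
proof
  fix k assume "\<forall>k. Ck_on k f S"
  then have "Ck_on (Suc k) f S" by blast
  then show "Ck_on k (\<lambda>x. fd f x v) S" by simp
qed

lemma smooth_on_bounded_linear:
  "bounded_linear L \<Longrightarrow> open S \<Longrightarrow> smooth_on f S \<Longrightarrow> smooth_on (\<lambda>x. L (f x)) S"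
  unfolding smooth_on_def using Ck_on_bounded_linear by blast

lemma smooth_on_imp_differentiable: "smooth_on f S \<Longrightarrow> x \<in> S \<Longrightarrow> f differentiable (at x)"
  unfolding smooth_on_def by (drule spec[of _ "Suc 0"]) simp

lemma smooth_on_imp_continuous_on: "smooth_on f S \<Longrightarrow> continuous_on S f"
  unfolding smooth_on_def by (drule spec[of _ 0]) simp

text \<open>The mean value theorem is applied twice: to the increment in direction \<open>b\<close>,
  as a function of the step along \<open>a\<close>, and then to the derivative along
  \<open>a\<close>, as a function of the step along \<open>b\<close>. The second difference itself
  is symmetric in \<open>a\<close> and \<open>b\<close>.\<close>

lemma second_difference_mvt:
  fixes f :: "'e::euclidean_space \<Rightarrow> real"
  assumes sm: "smooth_on f S" and h: "h > 0"
    and sq: "\<And>s t. 0 \<le> s \<Longrightarrow> s \<le> h \<Longrightarrow> 0 \<le> t \<Longrightarrow> t \<le> h \<Longrightarrow> x + s *\<^sub>R a + t *\<^sub>R b \<in> S"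
  shows "\<exists>s t. 0 \<le> s \<and> s \<le> h \<and> 0 \<le> t \<and> t \<le> h \<and>
    f (x + h *\<^sub>R a + h *\<^sub>R b) - f (x + h *\<^sub>R a) - f (x + h *\<^sub>R b) + f x
      = h * h * fd (\<lambda>y. fd f y a) (x + s *\<^sub>R a + t *\<^sub>R b) b"
proof -
  define \<phi> where "\<phi> = (\<lambda>s. f (x + s *\<^sub>R a + h *\<^sub>R b) - f (x + s *\<^sub>R a + 0 *\<^sub>R b))"
  define \<phi>' where "\<phi>' = (\<lambda>s. fd f (x + s *\<^sub>R a + h *\<^sub>R b) a - fd f (x + s *\<^sub>R a + 0 *\<^sub>R b) a)"
  have line_a: "((\<lambda>s. f (x + s *\<^sub>R a + t *\<^sub>R b)) has_real_derivative fd f (x + s *\<^sub>R a + t *\<^sub>R b) a) (at s)"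
    if "0 \<le> s" "s \<le> h" "0 \<le> t" "t \<le> h" for s t
  proof -
    have df: "f differentiable (at (x + s *\<^sub>R a + t *\<^sub>R b))"
      using smooth_on_imp_differentiable[OF sm sq[OF that]] .
    have "((\<lambda>s. f (x + s *\<^sub>R a + t *\<^sub>R b)) has_derivative (\<lambda>r. fd f (x + s *\<^sub>R a + t *\<^sub>R b) (r *\<^sub>R a))) (at s)"
      by (rule has_derivative_fd_compose[where G = "\<lambda>s. x + s *\<^sub>R a + t *\<^sub>R b", OF _ df])
        (auto intro!: derivative_eq_intros)
    then show ?thesis
      by (simp add: has_field_derivative_def linear_cmul[OF fd_linear[OF df]] mult_commute_abs)
  qed
  have "\<exists>z>0. z < h \<and> \<phi> h - \<phi> 0 = (h - 0) * \<phi>' z"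
    unfolding \<phi>_def \<phi>'_def
    by (rule MVT2[OF h]) (use h in \<open>auto intro!: DERIV_diff line_a line_a[where t=0, simplified]\<close>)
  then obtain s where s: "0 < s" "s < h" "\<phi> h - \<phi> 0 = h * \<phi>' s" by auto
  have line_b: "((\<lambda>t. fd f (x + s *\<^sub>R a + t *\<^sub>R b) a) has_real_derivative
      fd (\<lambda>y. fd f y a) (x + s *\<^sub>R a + t *\<^sub>R b) b) (at t)"
    if "0 \<le> t" "t \<le> h" for t
  proof -
    have df: "(\<lambda>y. fd f y a) differentiable (at (x + s *\<^sub>R a + t *\<^sub>R b))"
      using smooth_on_imp_differentiable[OF smooth_on_fd[OF sm] sq] s that by simp
    have "((\<lambda>t. fd f (x + s *\<^sub>R a + t *\<^sub>R b) a) has_derivative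
        (\<lambda>r. fd (\<lambda>y. fd f y a) (x + s *\<^sub>R a + t *\<^sub>R b) (r *\<^sub>R b))) (at t)"
      by (rule has_derivative_fd_compose[where G = "\<lambda>t. x + s *\<^sub>R a + t *\<^sub>R b", OF _ df])
        (auto intro!: derivative_eq_intros)
    then show ?thesis
      by (simp add: has_field_derivative_def linear_cmul[OF fd_linear[OF df]] mult_commute_abs)
  qed
  have "\<exists>z>0. z < h \<and> fd f (x + s *\<^sub>R a + h *\<^sub>R b) a - fd f (x + s *\<^sub>R a + 0 *\<^sub>R b) a
      = (h - 0) * fd (\<lambda>y. fd f y a) (x + s *\<^sub>R a + z *\<^sub>R b) b"
    by (rule MVT2[OF h]) (use line_b in auto)
  then obtain t where t: "0 < t" "t < h"
    "\<phi>' s = h * fd (\<lambda>y. fd f y a) (x + s *\<^sub>R a + t *\<^sub>R b) b"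
    by (auto simp: \<phi>'_def)
  have "f (x + h *\<^sub>R a + h *\<^sub>R b) - f (x + h *\<^sub>R a) - f (x + h *\<^sub>R b) + f x = \<phi> h - \<phi> 0"
    by (simp add: \<phi>_def)
  also have "\<dots> = h * h * fd (\<lambda>y. fd f y a) (x + s *\<^sub>R a + t *\<^sub>R b) b"
    using s(3) t(3) by simp
  finally show ?thesis using s t by (intro exI[of _ s] exI[of _ t]) auto
qed

text \<open>One and the same second difference equals \<open>h * h\<close> times \<open>p\<close> at
  one nearby point and \<open>h * h\<close> times \<open>q\<close> at another. Continuity of both
  mixed derivatives then forces equality at \<open>x\<close>.\<close>

lemma second_derivative_symmetric_real:
  fixes f :: "'e::euclidean_space \<Rightarrow> real"
  assumes "open S" "smooth_on f S" "x \<in> S"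
  shows "fd (\<lambda>y. fd f y a) x b = fd (\<lambda>y. fd f y b) x a"
proof -
  define p where "p = (\<lambda>y. fd (\<lambda>y. fd f y a) y b)"
  define q where "q = (\<lambda>y. fd (\<lambda>y. fd f y b) y a)"
  have cont: "continuous_on S p" "continuous_on S q"
    unfolding p_def q_def using smooth_on_imp_continuous_on[OF smooth_on_fd[OF smooth_on_fd[OF assms(2)]]]
    by auto
  have "\<bar>p x - q x\<bar> \<le> 0 + \<epsilon>" if "\<epsilon> > 0" for \<epsilon>
  proof -
    have "isCont p x" "isCont q x"
      using cont assms continuous_on_eq_continuous_at by blast+
    then obtain d1 d2 where d: "d1 > 0" "d2 > 0"
      "\<And>y. dist y x < d1 \<Longrightarrow> dist (p y) (p x) < \<epsilon>/2" "\<And>y. dist y x < d2 \<Longrightarrow> dist (q y) (q x) < \<epsilon>/2"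
      using \<open>\<epsilon> > 0\<close> unfolding continuous_at_eps_delta by (metis half_gt_zero)
    obtain d3 where d3: "d3 > 0" "ball x d3 \<subseteq> S"
      using assms(1,3) open_contains_ball by blast
    \<comment> \<open>\<open>r\<close> respects both continuity radii and a ball inside
      \<open>S\<close>; \<open>h\<close> keeps the whole parallelogram within \<open>r / 2\<close>
      of \<open>x\<close>. The 1 in the denominator covers \<open>a = b = 0\<close>.\<close>
    define r where "r = min d1 (min d2 d3)"
    define h where "h = r / (2 * (1 + norm a + norm b))"
    have r: "r > 0" using d d3 by (simp add: r_def)
    have n: "1 + norm a + norm b > 0" by (smt (verit) norm_ge_zero)
    then have h: "h > 0" using r by (simp add: h_def)
    have near: "dist (x + s *\<^sub>R u + t *\<^sub>R v) x < r"
      if "0 \<le> s" "s \<le> h" "0 \<le> t" "t \<le> h" and uv: "(u, v) = (a, b) \<or> (u, v) = (b, a)" for s t u v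
    proof -
      have "dist (x + s *\<^sub>R u + t *\<^sub>R v) x \<le> s * norm u + t * norm v"
        using norm_triangle_ineq[of "s *\<^sub>R u" "t *\<^sub>R v"] that by (simp add: dist_norm add.assoc)
      also have "\<dots> \<le> h * norm u + h * norm v"
        using that by (intro add_mono mult_right_mono) auto
      also have "\<dots> = h * (norm a + norm b)" using uv by (auto simp: algebra_simps)
      also have "\<dots> \<le> h * (1 + norm a + norm b)" using h by simp
      also have "\<dots> = r / 2" using n by (simp add: h_def field_simps)
      also have "\<dots> < r" using r by simp
      finally show ?thesis .
    qed
    have inS: "x + s *\<^sub>R u + t *\<^sub>R v \<in> S"
      if "0 \<le> s" "s \<le> h" "0 \<le> t" "t \<le> h" "(u, v) = (a, b) \<or> (u, v) = (b, a)" for s t u v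
      using near[OF that] d3(2) by (auto simp: r_def dist_commute)
    obtain s t where st: "0 \<le> s" "s \<le> h" "0 \<le> t" "t \<le> h"
      "f (x + h *\<^sub>R a + h *\<^sub>R b) - f (x + h *\<^sub>R a) - f (x + h *\<^sub>R b) + f x
        = h * h * p (x + s *\<^sub>R a + t *\<^sub>R b)"
      unfolding p_def using second_difference_mvt[OF assms(2) h, of x a b] inS by blast
    obtain s' t' where st': "0 \<le> s'" "s' \<le> h" "0 \<le> t'" "t' \<le> h"
      "f (x + h *\<^sub>R b + h *\<^sub>R a) - f (x + h *\<^sub>R b) - f (x + h *\<^sub>R a) + f x
        = h * h * q (x + s' *\<^sub>R b + t' *\<^sub>R a)"
      unfolding q_def using second_difference_mvt[OF assms(2) h, of x b a] inS by blast
    have "x + h *\<^sub>R b + h *\<^sub>R a = x + h *\<^sub>R a + h *\<^sub>R b" by simp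
    then have "h * h * p (x + s *\<^sub>R a + t *\<^sub>R b) = h * h * q (x + s' *\<^sub>R b + t' *\<^sub>R a)"
      using st(5) st'(5) unfolding \<open>x + h *\<^sub>R b + h *\<^sub>R a = x + h *\<^sub>R a + h *\<^sub>R b\<close> by linarith
    then have "p (x + s *\<^sub>R a + t *\<^sub>R b) = q (x + s' *\<^sub>R b + t' *\<^sub>R a)" using h by simp
    moreover have "dist (p (x + s *\<^sub>R a + t *\<^sub>R b)) (p x) < \<epsilon>/2"
      using d(3) near[OF st(1-4)] by (simp add: r_def)
    moreover have "dist (q (x + s' *\<^sub>R b + t' *\<^sub>R a)) (q x) < \<epsilon>/2"
      using d(4) near[OF st'(1-4)] by (simp add: r_def)
    ultimately show ?thesis by (simp add: dist_real_def abs_if split: if_splits)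
  qed
  then have "\<bar>p x - q x\<bar> \<le> 0" by (rule field_le_epsilon)
  then show ?thesis by (simp add: p_def q_def)
qed

lemma second_derivative_symmetric:
  fixes f :: "'e::euclidean_space \<Rightarrow> 'f::euclidean_space"
  assumes "open S" "smooth_on f S" "x \<in> S"
  shows "fd (\<lambda>y. fd f y a) x b = fd (\<lambda>y. fd f y b) x a"
proof (rule euclidean_eqI)
  fix i :: 'f
  have comp: "fd (\<lambda>y. g y \<bullet> i) y v = fd g y v \<bullet> i" if "smooth_on g S" "y \<in> S" for g y v
    by (rule fd_eqI[THEN fun_cong])
      (intro has_derivative_inner_left has_derivative_fd smooth_on_imp_differentiable[OF that])
  have 1: "fd (\<lambda>y. fd f y u) x v \<bullet> i = fd (\<lambda>y. fd (\<lambda>y. f y \<bullet> i) y u) x v" for u v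
  proof -
    have "fd (\<lambda>y. fd (\<lambda>y. f y \<bullet> i) y u) x = fd (\<lambda>y. fd f y u \<bullet> i) x"
      using smooth_on_imp_differentiable[OF smooth_on_fd[OF assms(2)] assms(3)]
      by (intro fd_cong_open(2)[OF _ assms(1,3)]) (auto simp: comp[OF assms(2)])
    then show ?thesis using comp[OF smooth_on_fd[OF assms(2)] assms(3)] by simp
  qed
  have "smooth_on (\<lambda>y. f y \<bullet> i) S"
    by (intro smooth_on_bounded_linear[OF bounded_linear_inner_left] assms)
  then show "fd (\<lambda>y. fd f y a) x b \<bullet> i = fd (\<lambda>y. fd f y b) x a \<bullet> i"
    using second_derivative_symmetric_real[OF assms(1) _ assms(3)] by (simp add: 1)
qed

section \<open>Pullback of a closed two-form\<close>

text \<open>Product rule for a bilinear form whose coefficients depend on the point.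
  Differentiability is assumed for fixed arguments only, so the form is expanded in the basis,
  differentiated termwise and reassembled.\<close>

lemma has_derivative_bilinear_family:
  fixes \<Omega> :: "'k::euclidean_space \<Rightarrow> 'k \<Rightarrow> 'k \<Rightarrow> real" and G B C :: "'e::euclidean_space \<Rightarrow> 'k"
  assumes "open W" "x \<in> W" "open T" "G ` W \<subseteq> T"
    and lin1: "\<And>y v. y \<in> T \<Longrightarrow> linear (\<lambda>u. \<Omega> y u v)" and lin2: "\<And>y u. y \<in> T \<Longrightarrow> linear (\<Omega> y u)"
    and diff: "\<And>y u v. y \<in> T \<Longrightarrow> (\<lambda>y. \<Omega> y u v) differentiable (at y)"
    and G: "(G has_derivative G') (at x)"
    and B: "(B has_derivative B') (at x)" and C: "(C has_derivative C') (at x)"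
  shows "((\<lambda>y. \<Omega> (G y) (B y) (C y)) has_derivative
    (\<lambda>v. fd (\<lambda>y. \<Omega> y (B x) (C x)) (G x) (G' v) + \<Omega> (G x) (B' v) (C x) + \<Omega> (G x) (B x) (C' v))) (at x)"
proof -
  have expand: "\<Omega> y u v = (\<Sum>i\<in>Basis. \<Sum>j\<in>Basis. (u \<bullet> i) * (v \<bullet> j) * \<Omega> y i j)" if "y \<in> T" for y u v
  proof -
    have "\<Omega> y u v = (\<Sum>i\<in>Basis. (u \<bullet> i) *\<^sub>R \<Omega> y i v)"
      using linear_basis_expansion[OF lin1[OF that], of u v] .
    also have "\<dots> = (\<Sum>i\<in>Basis. (u \<bullet> i) *\<^sub>R (\<Sum>j\<in>Basis. (v \<bullet> j) *\<^sub>R \<Omega> y i j))"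
      using linear_basis_expansion[OF lin2[OF that], of _ v] by (intro sum.cong arg_cong2[where f = "(*\<^sub>R)"] refl)
    finally show ?thesis by (simp add: sum_distrib_left mult.assoc)
  qed
  have Gx: "G x \<in> T" using assms(2,4) by blast
  have \<Omega>G: "((\<lambda>y. \<Omega> (G y) i j) has_derivative (\<lambda>v. fd (\<lambda>y. \<Omega> y i j) (G x) (G' v))) (at x)" for i j
    by (rule has_derivative_compose[OF G has_derivative_fd[OF diff[OF Gx]]])
  have fdexp: "fd (\<lambda>y. \<Omega> y u v) (G x) w
      = (\<Sum>i\<in>Basis. \<Sum>j\<in>Basis. (u \<bullet> i) * (v \<bullet> j) * fd (\<lambda>y. \<Omega> y i j) (G x) w)" for u v w
  proof -
    have "((\<lambda>y. \<Sum>i\<in>Basis. \<Sum>j\<in>Basis. (u \<bullet> i) * (v \<bullet> j) * \<Omega> y i j) has_derivative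
       (\<lambda>w. \<Sum>i\<in>Basis. \<Sum>j\<in>Basis. (u \<bullet> i) * (v \<bullet> j) * fd (\<lambda>y. \<Omega> y i j) (G x) w)) (at (G x))"
      by (intro has_derivative_sum has_derivative_mult_right has_derivative_fd diff Gx)
    then have "((\<lambda>y. \<Omega> y u v) has_derivative
       (\<lambda>w. \<Sum>i\<in>Basis. \<Sum>j\<in>Basis. (u \<bullet> i) * (v \<bullet> j) * fd (\<lambda>y. \<Omega> y i j) (G x) w)) (at (G x))"
      by (rule has_derivative_transform_within_open[OF _ \<open>open T\<close> Gx]) (rule expand[symmetric])
    then show ?thesis by (simp add: fd_eqI)
  qed
  have "((\<lambda>y. \<Sum>i\<in>Basis. \<Sum>j\<in>Basis. (B y \<bullet> i) * (C y \<bullet> j) * \<Omega> (G y) i j) has_derivative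
      (\<lambda>v. \<Sum>i\<in>Basis. \<Sum>j\<in>Basis. (B x \<bullet> i) * (C x \<bullet> j) * fd (\<lambda>y. \<Omega> y i j) (G x) (G' v)
        + ((B x \<bullet> i) * (C' v \<bullet> j) + (B' v \<bullet> i) * (C x \<bullet> j)) * \<Omega> (G x) i j)) (at x)"
    by (intro has_derivative_sum has_derivative_mult has_derivative_inner_left B C \<Omega>G)
  then have "((\<lambda>y. \<Omega> (G y) (B y) (C y)) has_derivative
      (\<lambda>v. \<Sum>i\<in>Basis. \<Sum>j\<in>Basis. (B x \<bullet> i) * (C x \<bullet> j) * fd (\<lambda>y. \<Omega> y i j) (G x) (G' v)
        + ((B x \<bullet> i) * (C' v \<bullet> j) + (B' v \<bullet> i) * (C x \<bullet> j)) * \<Omega> (G x) i j)) (at x)"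
  proof (rule has_derivative_transform_within_open[OF _ \<open>open W\<close> \<open>x \<in> W\<close>])
    show "(\<Sum>i\<in>Basis. \<Sum>j\<in>Basis. (B y \<bullet> i) * (C y \<bullet> j) * \<Omega> (G y) i j) = \<Omega> (G y) (B y) (C y)"
      if "y \<in> W" for y
      by (rule expand[symmetric]) (use assms(4) that in blast)
  qed
  moreover have "(\<lambda>v. \<Sum>i\<in>Basis. \<Sum>j\<in>Basis. (B x \<bullet> i) * (C x \<bullet> j) * fd (\<lambda>y. \<Omega> y i j) (G x) (G' v)
        + ((B x \<bullet> i) * (C' v \<bullet> j) + (B' v \<bullet> i) * (C x \<bullet> j)) * \<Omega> (G x) i j)
      = (\<lambda>v. fd (\<lambda>y. \<Omega> y (B x) (C x)) (G x) (G' v) + \<Omega> (G x) (B' v) (C x) + \<Omega> (G x) (B x) (C' v))"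
  proof (rule ext)
    fix v
    show "(\<Sum>i\<in>Basis. \<Sum>j\<in>Basis. (B x \<bullet> i) * (C x \<bullet> j) * fd (\<lambda>y. \<Omega> y i j) (G x) (G' v)
        + ((B x \<bullet> i) * (C' v \<bullet> j) + (B' v \<bullet> i) * (C x \<bullet> j)) * \<Omega> (G x) i j)
      = fd (\<lambda>y. \<Omega> y (B x) (C x)) (G x) (G' v) + \<Omega> (G x) (B' v) (C x) + \<Omega> (G x) (B x) (C' v)"
      unfolding fdexp[of "B x" "C x" "G' v"] expand[OF Gx, of "B' v" "C x"]
        expand[OF Gx, of "B x" "C' v"]
      by (simp add: sum.distrib distrib_right)
  qed
  ultimately show ?thesis by simp
qed

text \<open>Pullback commutes with the exterior derivative, here on constant vectors
  \<open>a\<close>, \<open>b\<close>, \<open>c\<close>. Each derivative contributes one term of the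
  exterior derivative of \<open>\<Omega>\<close> and two terms with second derivatives of
  \<open>G\<close>; these six cancel in pairs because second derivatives are symmetric and
  \<open>\<Omega>\<close> is skew.\<close>

lemma pullback_closed_form:
  fixes \<Omega> :: "'k::euclidean_space \<Rightarrow> 'k \<Rightarrow> 'k \<Rightarrow> real" and G :: "'e::euclidean_space \<Rightarrow> 'k"
  assumes "open W" "x \<in> W" "open T" "G ` W \<subseteq> T" and G: "smooth_on G W"
    and lin1: "\<And>y v. y \<in> T \<Longrightarrow> linear (\<lambda>u. \<Omega> y u v)" and lin2: "\<And>y u. y \<in> T \<Longrightarrow> linear (\<Omega> y u)"
    and diff: "\<And>y u v. y \<in> T \<Longrightarrow> (\<lambda>y. \<Omega> y u v) differentiable (at y)"
    and skew: "\<And>y u v. y \<in> T \<Longrightarrow> \<Omega> y u v = - \<Omega> y v u"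
    and closed: "\<And>y u v w. y \<in> T \<Longrightarrow>
      fd (\<lambda>y. \<Omega> y u v) y w + fd (\<lambda>y. \<Omega> y v w) y u + fd (\<lambda>y. \<Omega> y w u) y v = 0"
  shows "(\<lambda>y. \<Omega> (G y) (fd G y b) (fd G y c)) differentiable (at x)"
    and "fd (\<lambda>y. \<Omega> (G y) (fd G y b) (fd G y c)) x a + fd (\<lambda>y. \<Omega> (G y) (fd G y c) (fd G y a)) x b
      + fd (\<lambda>y. \<Omega> (G y) (fd G y a) (fd G y b)) x c = 0"
proof -
  have der: "((\<lambda>y. \<Omega> (G y) (fd G y u) (fd G y v)) has_derivative
    (\<lambda>w. fd (\<lambda>y. \<Omega> y (fd G x u) (fd G x v)) (G x) (fd G x w)
      + \<Omega> (G x) (fd (\<lambda>y. fd G y u) x w) (fd G x v)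
      + \<Omega> (G x) (fd G x u) (fd (\<lambda>y. fd G y v) x w))) (at x)" for u v
    by (rule has_derivative_bilinear_family[OF assms(1-4) lin1 lin2 diff])
      (use assms(2) in \<open>auto intro!: has_derivative_fd smooth_on_imp_differentiable[OF smooth_on_fd[OF G]]
        smooth_on_imp_differentiable[OF G]\<close>)
  then show "(\<lambda>y. \<Omega> (G y) (fd G y b) (fd G y c)) differentiable (at x)"
    unfolding differentiable_def by blast
  have Gx: "G x \<in> T" using assms by blast
  note sym = second_derivative_symmetric[OF assms(1) G assms(2)]
  show "fd (\<lambda>y. \<Omega> (G y) (fd G y b) (fd G y c)) x a + fd (\<lambda>y. \<Omega> (G y) (fd G y c) (fd G y a)) x b
      + fd (\<lambda>y. \<Omega> (G y) (fd G y a) (fd G y b)) x c = 0"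
    unfolding fd_eqI[OF der]
    using closed[OF Gx, of "fd G x b" "fd G x c" "fd G x a"] sym[of a b] sym[of b c] sym[of a c]
      skew[OF Gx, of "fd (\<lambda>y. fd G y a) x b" "fd G x c"] skew[OF Gx, of "fd (\<lambda>y. fd G y b) x c" "fd G x a"]
      skew[OF Gx, of "fd (\<lambda>y. fd G y a) x c" "fd G x b"]
    by simp
qed

section \<open>Charts and tangent vectors\<close>

text \<open>
  The part of the manifold axioms used for tangent spaces; unlike smoothness of the transition maps
  it passes to products without further calculus.
\<close>

locale charted_space =
  fixes M :: "('a, 'e::euclidean_space) mfd"
  assumes points_eq: "points M = (\<Union>c\<in>atlas M. cdom c)"
    and openin_cdom: "c \<in> atlas M \<Longrightarrow> openin (mtop M) (cdom c)"
    and inj_on_cmap: "c \<in> atlas M \<Longrightarrow> inj_on (cmap c) (cdom c)"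
    and open_cmap_image: "c \<in> atlas M \<Longrightarrow> openin (mtop M) V \<Longrightarrow> V \<subseteq> cdom c \<Longrightarrow> open (cmap c ` V)"
    and transition_differentiable: "c \<in> charts_at M p \<Longrightarrow> d \<in> charts_at M p \<Longrightarrow>
      (cmap d \<circ> cinv c) differentiable (at (cmap c p))"

lemma smooth_manifold_imp_charted_space:
  assumes "smooth_manifold M"
  shows "charted_space M"
proof
  show "points M = (\<Union>c\<in>atlas M. cdom c)"
    using assms by (simp add: smooth_manifold_def)
  have hom: "openin (mtop M) (cdom c)" "open (cmap c ` cdom c)"
    "homeomorphic_map (subtopology (mtop M) (cdom c)) (top_of_set (cmap c ` cdom c)) (cmap c)"
    if "c \<in> atlas M" for c
    using assms that unfolding smooth_manifold_def by blast+
  show "openin (mtop M) (cdom c)" if "c \<in> atlas M" for c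
    using hom that by blast
  show "inj_on (cmap c) (cdom c)" if "c \<in> atlas M" for c
  proof -
    have "topspace (subtopology (mtop M) (cdom c)) = cdom c"
      using openin_subset[OF hom(1)[OF that]] by auto
    then show ?thesis using homeomorphic_imp_injective_map[OF hom(3)[OF that]] by simp
  qed
  show "open (cmap c ` V)" if "c \<in> atlas M" "openin (mtop M) V" "V \<subseteq> cdom c" for c V
  proof -
    have "openin (subtopology (mtop M) (cdom c)) V"
      using that hom(1) by (simp add: openin_open_subtopology)
    then have "openin (top_of_set (cmap c ` cdom c)) (cmap c ` V)"
      using homeomorphic_imp_open_map[OF hom(3)[OF that(1)]] by (simp add: open_map_def)
    then show ?thesis using hom(2)[OF that(1)] openin_open_eq by blast
  qed
  show "(cmap d \<circ> cinv c) differentiable (at (cmap c p))"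
    if "c \<in> charts_at M p" "d \<in> charts_at M p" for c d p
  proof -
    have "smooth_on (cmap d \<circ> cinv c) (cmap c ` (cdom c \<inter> cdom d))"
      using assms that unfolding smooth_manifold_def charts_at_def by blast
    then show ?thesis
      by (rule smooth_on_imp_differentiable) (use that in \<open>auto simp: charts_at_def\<close>)
  qed
qed

text \<open>For fixed \<open>d\<close> and \<open>u\<close> and varying \<open>p\<close> these are
  the constant-coefficient coordinate fields of the chart \<open>d\<close>, whose Lie brackets
  vanish. The default 0 follows the convention of \<open>tangent\<close>.\<close>

definition coord_vec :: "('a, 'e::euclidean_space) mfd \<Rightarrow> ('a, 'e) chart \<Rightarrow> 'a \<Rightarrow> 'e \<Rightarrow> ('a, 'e) tvec" where
  "coord_vec M d p u = (\<lambda>c. if c \<in> charts_at M p then fd (cmap c \<circ> cinv d) (cmap d p) u else 0)"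

context charted_space
begin

lemma charts_at_points: "c \<in> charts_at M p \<Longrightarrow> p \<in> points M"
  unfolding points_eq charts_at_def by blast

lemma cinv_cmap: "c \<in> atlas M \<Longrightarrow> p \<in> cdom c \<Longrightarrow> cinv c (cmap c p) = p"
  unfolding cinv_def using inj_on_cmap by simp

lemma cinv_cmap_at: "c \<in> charts_at M p \<Longrightarrow> cinv c (cmap c p) = p"
  by (simp add: charts_at_def cinv_cmap)

lemma some_chart_at: "p \<in> points M \<Longrightarrow> some_chart M p \<in> charts_at M p"
  unfolding some_chart_def points_eq by (rule someI_ex) (auto simp: charts_at_def)

lemma open_chart_image: "c \<in> atlas M \<Longrightarrow> open (cmap c ` cdom c)"
  by (simp add: open_cmap_image openin_cdom)

lemma open_overlap: "c \<in> atlas M \<Longrightarrow> d \<in> atlas M \<Longrightarrow> open (cmap c ` (cdom c \<inter> cdom d))"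
  by (simp add: open_cmap_image openin_cdom openin_Int)

text \<open>Chain rule through the transition map. With \<open>h\<close> a coordinate map it is the
  cocycle identity \<open>fd_chart_trans\<close>; with \<open>h\<close> a function or
  \<open>cmap d \<circ> F\<close> it frees \<open>dir_deriv\<close> and \<open>diff_map\<close> from
  the chart picked by \<open>some_chart\<close>.\<close>

lemma has_derivative_chart_change:
  assumes c: "c \<in> charts_at M p" and d: "d \<in> charts_at M p"
    and h: "((h \<circ> cinv d) has_derivative D) (at (cmap d p))"
  shows "((h \<circ> cinv c) has_derivative (\<lambda>u. D (fd (cmap d \<circ> cinv c) (cmap c p) u))) (at (cmap c p))"
proof -
  have atl: "c \<in> atlas M" "d \<in> atlas M" "p \<in> cdom c" "p \<in> cdom d"
    using c d by (auto simp: charts_at_def)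
  have "((\<lambda>x. (h \<circ> cinv d) ((cmap d \<circ> cinv c) x)) has_derivative
      (\<lambda>u. D (fd (cmap d \<circ> cinv c) (cmap c p) u))) (at (cmap c p))"
    by (rule has_derivative_compose[OF has_derivative_fd[OF transition_differentiable[OF c d]]])
      (use h in \<open>simp only: comp_apply[of "cmap d"] cinv_cmap[OF atl(1,3)]\<close>)
  then show ?thesis
    by (rule has_derivative_transform_within_open[OF _ open_overlap[OF atl(1,2)]])
      (use atl cinv_cmap[OF atl(1)] cinv_cmap[OF atl(2)] in auto)
qed

lemma fd_chart_self:
  assumes "c \<in> charts_at M p"
  shows "fd (cmap c \<circ> cinv c) (cmap c p) u = u"
proof -
  have c: "c \<in> atlas M" "p \<in> cdom c" using assms by (auto simp: charts_at_def)
  have "((\<lambda>x. x) has_derivative (\<lambda>u. u)) (at (cmap c p))" by simp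
  then have "((cmap c \<circ> cinv c) has_derivative (\<lambda>u. u)) (at (cmap c p))"
    by (rule has_derivative_transform_within_open[OF _ open_chart_image[OF c(1)]])
      (use c cinv_cmap[OF c(1)] in auto)
  then show ?thesis by (simp add: fd_eqI)
qed

lemma fd_chart_trans:
  assumes "c \<in> charts_at M p" "d \<in> charts_at M p" "e \<in> charts_at M p"
  shows "fd (cmap e \<circ> cinv d) (cmap d p) (fd (cmap d \<circ> cinv c) (cmap c p) u)
    = fd (cmap e \<circ> cinv c) (cmap c p) u"
  using fd_eqI[OF has_derivative_chart_change[OF assms(1,2)
        has_derivative_fd[OF transition_differentiable[OF assms(2,3)]]]] by simp

lemma linear_transition:
  "c \<in> charts_at M p \<Longrightarrow> d \<in> charts_at M p \<Longrightarrow> linear (fd (cmap d \<circ> cinv c) (cmap c p))"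
  by (intro fd_linear transition_differentiable)

lemma tangentD:
  "v \<in> tangent M p \<Longrightarrow> c \<in> charts_at M p \<Longrightarrow> d \<in> charts_at M p \<Longrightarrow>
    v d = fd (cmap d \<circ> cinv c) (cmap c p) (v c)"
  unfolding tangent_def by blast

lemma tangent_outside: "v \<in> tangent M p \<Longrightarrow> c \<notin> charts_at M p \<Longrightarrow> v c = 0"
  unfolding tangent_def by blast

lemma tangent_eqI:
  assumes "v \<in> tangent M p" "w \<in> tangent M p" "c \<in> charts_at M p" "v c = w c"
  shows "v = w"
proof
  fix d show "v d = w d"
  proof (cases "d \<in> charts_at M p")
    case True
    then show ?thesis
      using tangentD[OF assms(1,3) True] tangentD[OF assms(2,3) True] assms(4) by simp
  next
    case False
    then show ?thesis
      using tangent_outside[OF assms(1) False] tangent_outside[OF assms(2) False] by simp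
  qed
qed

lemma coord_vec_tangent: "d \<in> charts_at M p \<Longrightarrow> coord_vec M d p u \<in> tangent M p"
  unfolding tangent_def coord_vec_def by (simp add: fd_chart_trans)

lemma coord_vec_self: "d \<in> charts_at M p \<Longrightarrow> coord_vec M d p u d = u"
  by (simp add: coord_vec_def fd_chart_self)

lemma coord_vec_tangent_eq: "v \<in> tangent M p \<Longrightarrow> d \<in> charts_at M p \<Longrightarrow> coord_vec M d p (v d) = v"
  by (rule tangent_eqI[of _ p _ d]) (auto simp: coord_vec_tangent coord_vec_self)

lemma lincomb_tangent:
  assumes "v \<in> tangent M p" "w \<in> tangent M p"
  shows "lincomb a v b w \<in> tangent M p"
  unfolding tangent_def lincomb_def
proof (intro CollectI conjI ballI allI impI)
  fix c d assume cd: "c \<in> charts_at M p" "d \<in> charts_at M p"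
  show "a *\<^sub>R v d + b *\<^sub>R w d = fd (cmap d \<circ> cinv c) (cmap c p) (a *\<^sub>R v c + b *\<^sub>R w c)"
    using linear_transition[OF cd] tangentD[OF assms(1) cd] tangentD[OF assms(2) cd]
    by (simp add: linear_add linear_cmul)
qed (simp add: tangent_outside[OF assms(1)] tangent_outside[OF assms(2)])

lemma zero_tangent: "p \<in> points M \<Longrightarrow> (\<lambda>_. 0) \<in> tangent M p"
  unfolding tangent_def by (simp add: linear_0[OF linear_transition])

lemma coord_vec_linear:
  assumes "d \<in> charts_at M p"
  shows "coord_vec M d p (a *\<^sub>R u + b *\<^sub>R v) = lincomb a (coord_vec M d p u) b (coord_vec M d p v)"
  by (rule tangent_eqI[OF coord_vec_tangent[OF assms]
        lincomb_tangent[OF coord_vec_tangent[OF assms] coord_vec_tangent[OF assms]] assms])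
    (simp add: coord_vec_self[OF assms] lincomb_def)

lemma dir_deriv_eq:
  assumes "c \<in> charts_at M p" "v \<in> tangent M p" "(h \<circ> cinv c) differentiable (at (cmap c p))"
  shows "dir_deriv M p v h = fd (h \<circ> cinv c) (cmap c p) (v c)"
proof -
  have s: "some_chart M p \<in> charts_at M p"
    using some_chart_at charts_at_points[OF assms(1)] by blast
  show ?thesis
    using fd_eqI[OF has_derivative_chart_change[OF s assms(1) has_derivative_fd[OF assms(3)]]]
      tangentD[OF assms(2) s assms(1)]
    by (simp add: dir_deriv_def Let_def)
qed

lemma diff_map_eq:
  assumes "c \<in> charts_at M p" "v \<in> tangent M p" "d \<in> charts_at N (F p)"
    and "(cmap d \<circ> F \<circ> cinv c) differentiable (at (cmap c p))"
  shows "diff_map M N F p v d = fd (cmap d \<circ> F \<circ> cinv c) (cmap c p) (v c)"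
proof -
  have s: "some_chart M p \<in> charts_at M p"
    using some_chart_at charts_at_points[OF assms(1)] by blast
  show ?thesis
    using fd_eqI[OF has_derivative_chart_change[OF s assms(1) has_derivative_fd[OF assms(4)]]]
      tangentD[OF assms(2) s assms(1)] assms(3)
    by (simp add: diff_map_def Let_def)
qed

lemma diff_map_outside: "d \<notin> charts_at N (F p) \<Longrightarrow> diff_map M N F p v d = 0"
  by (simp add: diff_map_def Let_def)

end

section \<open>Smooth maps and their differentials in charts\<close>

lemma smooth_map_local:
  assumes "charted_space M" "charted_space N" "smooth_map M N F" "c \<in> atlas M" "d \<in> atlas N"
  shows "open (cmap c ` {p \<in> cdom c. F p \<in> cdom d})"
    and "smooth_on (cmap d \<circ> F \<circ> cinv c) (cmap c ` {p \<in> cdom c. F p \<in> cdom d})"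
proof -
  interpret M: charted_space M by fact
  interpret N: charted_space N by fact
  have "openin (mtop M) (cdom c \<inter> {p \<in> points M. F p \<in> cdom d})"
    using assms(3) M.openin_cdom[OF assms(4)] N.openin_cdom[OF assms(5)]
    unfolding smooth_map_def continuous_map_def by (intro openin_Int) auto
  moreover have "cdom c \<inter> {p \<in> points M. F p \<in> cdom d} = {p \<in> cdom c. F p \<in> cdom d}"
    using M.points_eq assms(4) by blast
  ultimately show "open (cmap c ` {p \<in> cdom c. F p \<in> cdom d})"
    using M.open_cmap_image[OF assms(4)] by simp
  show "smooth_on (cmap d \<circ> F \<circ> cinv c) (cmap c ` {p \<in> cdom c. F p \<in> cdom d})"
    using assms(3-5) unfolding smooth_map_def by blast
qed

lemma smooth_map_differentiable:
  assumes "charted_space M" "charted_space N" "smooth_map M N F" "c \<in> charts_at M p" "d \<in> charts_at N (F p)"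
  shows "(cmap d \<circ> F \<circ> cinv c) differentiable (at (cmap c p))"
  using smooth_on_imp_differentiable[OF smooth_map_local(2)[OF assms(1-3)]] assms(4,5)
  unfolding charts_at_def by blast

lemma smooth_map_points: "smooth_map M N F \<Longrightarrow> p \<in> points M \<Longrightarrow> F p \<in> points N"
  unfolding smooth_map_def continuous_map_def by blast

lemma diff_map_tangent:
  assumes "charted_space M" "charted_space N" "smooth_map M N F" "p \<in> points M" "v \<in> tangent M p"
  shows "diff_map M N F p v \<in> tangent N (F p)"
  unfolding tangent_def
proof (intro CollectI conjI ballI allI impI)
  interpret M: charted_space M by fact
  interpret N: charted_space N by fact
  show "diff_map M N F p v d = 0" if "d \<notin> charts_at N (F p)" for d
    using that by (rule M.diff_map_outside)
  fix d e assume d: "d \<in> charts_at N (F p)" and e: "e \<in> charts_at N (F p)"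
  define c where "c = some_chart M p"
  have c: "c \<in> charts_at M p" using M.some_chart_at[OF assms(4)] by (simp add: c_def)
  have cd: "c \<in> atlas M" "d \<in> atlas N" "p \<in> cdom c" "F p \<in> cdom d"
    using c d by (auto simp: charts_at_def)
  note dif = smooth_map_differentiable[OF assms(1-3) c]
  have eq: "(cmap d \<circ> F \<circ> cinv c) (cmap c p) = cmap d (F p)"
    using M.cinv_cmap[OF cd(1,3)] by simp
  have "((\<lambda>x. (cmap e \<circ> cinv d) ((cmap d \<circ> F \<circ> cinv c) x)) has_derivative
     (\<lambda>u. fd (cmap e \<circ> cinv d) ((cmap d \<circ> F \<circ> cinv c) (cmap c p)) (fd (cmap d \<circ> F \<circ> cinv c) (cmap c p) u)))
     (at (cmap c p))"
    by (rule has_derivative_fd_compose[OF has_derivative_fd[OF dif[OF d]]])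
      (use N.transition_differentiable[OF d e] in \<open>simp only: eq\<close>)
  then have "((cmap e \<circ> F \<circ> cinv c) has_derivative
     (\<lambda>u. fd (cmap e \<circ> cinv d) (cmap d (F p)) (fd (cmap d \<circ> F \<circ> cinv c) (cmap c p) u))) (at (cmap c p))"
    unfolding eq
    by (rule has_derivative_transform_within_open[OF _ smooth_map_local(1)[OF assms(1-3) cd(1,2)]])
      (use M.cinv_cmap[OF cd(1)] N.cinv_cmap[OF cd(2)] cd in auto)
  then show "diff_map M N F p v e = fd (cmap e \<circ> cinv d) (cmap d (F p)) (diff_map M N F p v d)"
    using M.diff_map_eq[OF c assms(5) d dif[OF d]] M.diff_map_eq[OF c assms(5) e dif[OF e]]
    by (simp add: fd_eqI)
qed

text \<open>Chain rule for \<open>F\<close> after \<open>j\<close>, where \<open>j\<close> enters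
  only through its chart expression \<open>A\<close>. It serves the inclusions of the factors into a
  product, whose expressions in product charts are affine.\<close>

lemma diff_map_precompose:
  assumes "charted_space M" "charted_space N" "charted_space P" "smooth_map N P F"
    and c: "c \<in> charts_at M x" and e: "e \<in> charts_at N (j x)" and u: "u \<in> tangent M x"
    and S: "open S" "cmap c x \<in> S" "\<And>\<xi>. \<xi> \<in> S \<Longrightarrow> j (cinv c \<xi>) = cinv e (A \<xi>)"
    and A: "(A has_derivative L) (at (cmap c x))" "A (cmap c x) = cmap e (j x)"
  shows "diff_map M P (\<lambda>x. F (j x)) x u = diff_map N P F (j x) (coord_vec N e (j x) (L (u c)))"
proof
  interpret M: charted_space M by fact
  interpret N: charted_space N by fact
  fix d
  show "diff_map M P (\<lambda>x. F (j x)) x u d = diff_map N P F (j x) (coord_vec N e (j x) (L (u c))) d"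
  proof (cases "d \<in> charts_at P (F (j x))")
    case True
    note dif = smooth_map_differentiable[OF assms(2-4) e True]
    have "((\<lambda>\<xi>. (cmap d \<circ> F \<circ> cinv e) (A \<xi>)) has_derivative
        (\<lambda>u. fd (cmap d \<circ> F \<circ> cinv e) (A (cmap c x)) (L u))) (at (cmap c x))"
      by (rule has_derivative_fd_compose[OF A(1)]) (use dif in \<open>simp only: A(2)\<close>)
    then have der: "((cmap d \<circ> (\<lambda>x. F (j x)) \<circ> cinv c) has_derivative
        (\<lambda>u. fd (cmap d \<circ> F \<circ> cinv e) (cmap e (j x)) (L u))) (at (cmap c x))"
      unfolding A(2)[symmetric]
      by (rule has_derivative_transform_within_open[OF _ S(1,2)]) (use S(3) in simp)
    then have "(cmap d \<circ> (\<lambda>x. F (j x)) \<circ> cinv c) differentiable (at (cmap c x))"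
      by (auto simp: differentiable_def)
    from M.diff_map_eq[OF c u _ this, where N=P] True
    have "diff_map M P (\<lambda>x. F (j x)) x u d = fd (cmap d \<circ> (\<lambda>x. F (j x)) \<circ> cinv c) (cmap c x) (u c)"
      by blast
    also have "\<dots> = fd (cmap d \<circ> F \<circ> cinv e) (cmap e (j x)) (L (u c))"
      by (rule fd_eqI[OF der, THEN fun_cong])
    also have "\<dots> = diff_map N P F (j x) (coord_vec N e (j x) (L (u c))) d"
      using N.diff_map_eq[OF e N.coord_vec_tangent[OF e] True dif] N.coord_vec_self[OF e] by simp
    finally show ?thesis .
  next
    case False
    then show ?thesis by (simp add: diff_map_def Let_def)
  qed
qed

text \<open>Serves the projections of a product onto its factors: they are linear in product charts,
  hence equal to their own derivatives there.\<close>

lemma diff_map_linear_in_charts: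
  assumes "charted_space N" "charted_space M"
    and c: "c \<in> charts_at N p" and e: "e \<in> charts_at M (\<pi> p)" and v: "v \<in> tangent N p"
    and S: "open S" "cmap c p \<in> S" "\<And>\<xi>. \<xi> \<in> S \<Longrightarrow> \<pi> (cinv c \<xi>) = cinv e (L \<xi>)"
    and L: "bounded_linear L" "L (cmap c p) = cmap e (\<pi> p)"
  shows "diff_map N M \<pi> p v = coord_vec M e (\<pi> p) (L (v c))"
proof
  interpret N: charted_space N by fact
  interpret M: charted_space M by fact
  fix d
  show "diff_map N M \<pi> p v d = coord_vec M e (\<pi> p) (L (v c)) d"
  proof (cases "d \<in> charts_at M (\<pi> p)")
    case True
    have "((\<lambda>\<xi>. (cmap d \<circ> cinv e) (L \<xi>)) has_derivative
        (\<lambda>u. fd (cmap d \<circ> cinv e) (L (cmap c p)) (L u))) (at (cmap c p))"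
      by (rule has_derivative_fd_compose[OF bounded_linear_imp_has_derivative[OF L(1)]])
        (use M.transition_differentiable[OF e True] in \<open>simp only: L(2)\<close>)
    then have der: "((cmap d \<circ> \<pi> \<circ> cinv c) has_derivative
        (\<lambda>u. fd (cmap d \<circ> cinv e) (cmap e (\<pi> p)) (L u))) (at (cmap c p))"
      unfolding L(2)[symmetric]
      by (rule has_derivative_transform_within_open[OF _ S(1,2)]) (use S(3) in simp)
    then have "(cmap d \<circ> \<pi> \<circ> cinv c) differentiable (at (cmap c p))"
      by (auto simp: differentiable_def)
    from N.diff_map_eq[OF c v True this] show ?thesis
      using True by (simp add: fd_eqI[OF der] coord_vec_def)
  next
    case False
    then show ?thesis by (simp add: diff_map_def coord_vec_def Let_def)
  qed
qed

section \<open>Products\<close>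

definition prod_chart :: "('a, 'e) chart \<Rightarrow> ('b, 'f) chart \<Rightarrow> ('a \<times> 'b, 'e \<times> 'f) chart" where
  "prod_chart c d = (cdom c \<times> cdom d, map_prod (cmap c) (cmap d))"

lemma cdom_prod_chart [simp]: "cdom (prod_chart c d) = cdom c \<times> cdom d"
  and cmap_prod_chart [simp]: "cmap (prod_chart c d) = map_prod (cmap c) (cmap d)"
  by (auto simp: prod_chart_def)

lemma atlas_prod_mfd: "atlas (prod_mfd M N) = {prod_chart c d | c d. c \<in> atlas M \<and> d \<in> atlas N}"
  by (simp add: prod_mfd_def prod_chart_def)

lemma mtop_prod_mfd [simp]: "mtop (prod_mfd M N) = prod_topology (mtop M) (mtop N)"
  by (simp add: prod_mfd_def)

lemma charts_at_prod:
  "charts_at (prod_mfd M N) (p, q) = {prod_chart c d | c d. c \<in> charts_at M p \<and> d \<in> charts_at N q}"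
  unfolding charts_at_def atlas_prod_mfd set_eq_iff mem_Collect_eq
  by (metis cdom_prod_chart mem_Sigma_iff)

lemma cinv_prod_chart:
  assumes "inj_on (cmap c) (cdom c)" "inj_on (cmap d) (cdom d)"
    and "\<xi> \<in> cmap c ` cdom c" "\<eta> \<in> cmap d ` cdom d"
  shows "cinv (prod_chart c d) (\<xi>, \<eta>) = (cinv c \<xi>, cinv d \<eta>)"
proof -
  obtain x y where xy: "x \<in> cdom c" "\<xi> = cmap c x" "y \<in> cdom d" "\<eta> = cmap d y"
    using assms(3,4) by blast
  have "inj_on (map_prod (cmap c) (cmap d)) (cdom c \<times> cdom d)"
    using assms(1,2) by (rule map_prod_inj_on)
  then have "cinv (prod_chart c d) (map_prod (cmap c) (cmap d) (x, y)) = (x, y)"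
    unfolding cinv_def cdom_prod_chart cmap_prod_chart by (rule inv_into_f_f) (use xy in auto)
  then show ?thesis using xy assms(1,2) by (simp add: cinv_def)
qed

lemma charted_space_prod:
  assumes "charted_space M" "charted_space N"
  shows "charted_space (prod_mfd M N)"
proof
  interpret M: charted_space M by fact
  interpret N: charted_space N by fact
  show "points (prod_mfd M N) = (\<Union>c\<in>atlas (prod_mfd M N). cdom c)"
  proof (rule set_eqI)
    fix z
    have "z \<in> points (prod_mfd M N) \<longleftrightarrow> (\<exists>c\<in>atlas M. \<exists>d\<in>atlas N. z \<in> cdom c \<times> cdom d)"
      unfolding mtop_prod_mfd topspace_prod_topology M.points_eq N.points_eq by blast
    also have "\<dots> \<longleftrightarrow> z \<in> (\<Union>c\<in>atlas (prod_mfd M N). cdom c)"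
      unfolding atlas_prod_mfd cdom_prod_chart[symmetric] by blast
    finally show "z \<in> points (prod_mfd M N) \<longleftrightarrow> z \<in> (\<Union>c\<in>atlas (prod_mfd M N). cdom c)" .
  qed
  show "openin (mtop (prod_mfd M N)) (cdom c)" if "c \<in> atlas (prod_mfd M N)" for c
    using that M.openin_cdom N.openin_cdom by (auto simp: atlas_prod_mfd openin_prod_Times_iff)
  show "inj_on (cmap c) (cdom c)" if "c \<in> atlas (prod_mfd M N)" for c
    using that M.inj_on_cmap N.inj_on_cmap by (auto simp: atlas_prod_mfd intro!: map_prod_inj_on)
  show "open (cmap c ` V)"
    if "c \<in> atlas (prod_mfd M N)" "openin (mtop (prod_mfd M N)) V" "V \<subseteq> cdom c" for c V
  proof -
    from that(1) obtain c1 c2 where c: "c = prod_chart c1 c2" "c1 \<in> atlas M" "c2 \<in> atlas N"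
      unfolding atlas_prod_mfd by blast
    \<comment> \<open>An open subset of the product need not be a rectangle, so openness of its
      image is checked point by point with rectangles inside \<open>V\<close>.\<close>
    show ?thesis
    proof (subst open_subopen, intro ballI)
      fix z assume "z \<in> cmap c ` V"
      then obtain x y where xy: "(x, y) \<in> V" "z = (cmap c1 x, cmap c2 y)"
        by (auto simp: c)
      have "\<exists>U1 U2. openin (mtop M) U1 \<and> openin (mtop N) U2 \<and> x \<in> U1 \<and> y \<in> U2 \<and> U1 \<times> U2 \<subseteq> V"
        using that(2) xy(1) by (simp add: openin_prod_topology_alt)
      then obtain U1 U2 where
        U: "openin (mtop M) U1" "openin (mtop N) U2" "x \<in> U1" "y \<in> U2" "U1 \<times> U2 \<subseteq> V"
        by blast
      have "U1 \<subseteq> cdom c1" "U2 \<subseteq> cdom c2" using U that(3) by (auto simp: c)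
      then have "open ((cmap c1 ` U1) \<times> (cmap c2 ` U2))"
        using U c by (intro open_Times M.open_cmap_image N.open_cmap_image) auto
      moreover have "z \<in> (cmap c1 ` U1) \<times> (cmap c2 ` U2)" using xy U by auto
      moreover have "(cmap c1 ` U1) \<times> (cmap c2 ` U2) \<subseteq> cmap c ` V"
        using U(5) by (force simp: c)
      ultimately show "\<exists>T. open T \<and> z \<in> T \<and> T \<subseteq> cmap c ` V" by blast
    qed
  qed
  show "(cmap d \<circ> cinv c) differentiable (at (cmap c r))"
    if "c \<in> charts_at (prod_mfd M N) r" "d \<in> charts_at (prod_mfd M N) r" for c d r
  proof -
    obtain p q where r: "r = (p, q)" by fastforce
    from that obtain c1 c2 d1 d2 where cd: "c = prod_chart c1 c2" "d = prod_chart d1 d2"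
      "c1 \<in> charts_at M p" "c2 \<in> charts_at N q" "d1 \<in> charts_at M p" "d2 \<in> charts_at N q"
      unfolding r charts_at_prod by blast
    have atl: "c1 \<in> atlas M" "c2 \<in> atlas N" "p \<in> cdom c1" "q \<in> cdom c2"
      using cd by (auto simp: charts_at_def)
    have fstcd: "fst (cmap c r) = cmap c1 p" and sndcd: "snd (cmap c r) = cmap c2 q"
      by (simp_all add: cd(1) r)
    have 1: "((\<lambda>z. ((cmap d1 \<circ> cinv c1) (fst z), (cmap d2 \<circ> cinv c2) (snd z))) has_derivative
        (\<lambda>u. (fd (cmap d1 \<circ> cinv c1) (fst (cmap c r)) (fst u), fd (cmap d2 \<circ> cinv c2) (snd (cmap c r)) (snd u))))
        (at (cmap c r))"
      by (rule has_derivative_Pair; rule has_derivative_fd_compose)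
        (use M.transition_differentiable[OF cd(3,5)] N.transition_differentiable[OF cd(4,6)]
          in \<open>simp_all only: fstcd sndcd has_derivative_fst has_derivative_snd has_derivative_ident\<close>)
    have "open ((cmap c1 ` cdom c1) \<times> (cmap c2 ` cdom c2))"
      by (intro open_Times M.open_chart_image N.open_chart_image atl)
    moreover have "cmap c r \<in> (cmap c1 ` cdom c1) \<times> (cmap c2 ` cdom c2)"
      using atl by (auto simp: cd r)
    ultimately have "((cmap d \<circ> cinv c) has_derivative
        (\<lambda>u. (fd (cmap d1 \<circ> cinv c1) (fst (cmap c r)) (fst u), fd (cmap d2 \<circ> cinv c2) (snd (cmap c r)) (snd u))))
        (at (cmap c r))"
      using cinv_prod_chart[OF M.inj_on_cmap[OF atl(1)] N.inj_on_cmap[OF atl(2)]]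
      by (intro has_derivative_transform_within_open[OF 1]) (auto simp: cd)
    then show ?thesis by (auto simp: differentiable_def)
  qed
qed

section \<open>The Kaehler form is closed\<close>

lemma riemannian_metric_sym:
  "riemannian_metric M g \<Longrightarrow> p \<in> points M \<Longrightarrow> u \<in> tangent M p \<Longrightarrow> v \<in> tangent M p \<Longrightarrow>
    g p u v = g p v u"
  unfolding riemannian_metric_def by blast

lemma riemannian_metric_pos:
  "riemannian_metric M g \<Longrightarrow> p \<in> points M \<Longrightarrow> u \<in> tangent M p \<Longrightarrow> u \<noteq> (\<lambda>_. 0) \<Longrightarrow> g p u u > 0"
  unfolding riemannian_metric_def by blast

lemma riemannian_metric_lincomb_left:
  "riemannian_metric M g \<Longrightarrow> p \<in> points M \<Longrightarrow> u \<in> tangent M p \<Longrightarrow> v \<in> tangent M p \<Longrightarrow>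
    w \<in> tangent M p \<Longrightarrow> g p (lincomb a u b v) w = a * g p u w + b * g p v w"
  unfolding riemannian_metric_def by blast

section \<open>Linear algebra of a Riemannian metric at a point\<close>

context charted_space
begin

lemma riemannian_metric_lincomb_right:
  assumes "riemannian_metric M g" "p \<in> points M" "u \<in> tangent M p" "v \<in> tangent M p" "w \<in> tangent M p"
  shows "g p w (lincomb a u b v) = a * g p w u + b * g p w v"
  using riemannian_metric_lincomb_left[OF assms, of a b]
    riemannian_metric_sym[OF assms(1,2,5) lincomb_tangent[OF assms(3,4)], of a b]
    riemannian_metric_sym[OF assms(1,2,5,3)] riemannian_metric_sym[OF assms(1,2,5,4)]
  by simp

lemma riemannian_metric_zero_left:
  assumes "riemannian_metric M g" "p \<in> points M" "w \<in> tangent M p"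
  shows "g p (\<lambda>_. 0) w = 0"
proof -
  have "g p (lincomb 0 w 0 w) w = 0"
    using riemannian_metric_lincomb_left[OF assms(1,2,3,3,3), of 0 0] by simp
  moreover have "lincomb 0 w 0 w = (\<lambda>_. 0)" by (simp add: lincomb_def)
  ultimately show ?thesis by metis
qed

lemma riemannian_metric_nonneg:
  assumes "riemannian_metric M g" "p \<in> points M" "u \<in> tangent M p"
  shows "g p u u \<ge> 0"
proof (cases "u = (\<lambda>_. 0)")
  case True
  then show ?thesis using riemannian_metric_zero_left[OF assms] by simp
next
  case False
  then show ?thesis using riemannian_metric_pos[OF assms] by simp
qed

text \<open>This is \<open>0 \<le> g p w w\<close> for \<open>w = a u - b v\<close>, expanded. The
  weights stay free: suitable lengths give Cauchy-Schwarz, and \<open>a = b = 1\<close> compares two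
  vectors of equal length.\<close>

lemma riemannian_metric_am_gm:
  assumes "riemannian_metric M g" "p \<in> points M" "u \<in> tangent M p" "v \<in> tangent M p"
  shows "2 * (a * b) * g p u v \<le> a\<^sup>2 * g p u u + b\<^sup>2 * g p v v"
proof -
  let ?w = "lincomb a u (-b) v"
  have "?w \<in> tangent M p" using assms by (simp add: lincomb_tangent)
  then have "0 \<le> g p ?w ?w" using riemannian_metric_nonneg assms by blast
  also have "g p ?w ?w = a * g p u ?w + (-b) * g p v ?w"
    by (rule riemannian_metric_lincomb_left[OF assms(1-4) \<open>?w \<in> tangent M p\<close>])
  also have "\<dots> = a\<^sup>2 * g p u u - 2 * (a * b) * g p u v + b\<^sup>2 * g p v v"
    unfolding riemannian_metric_lincomb_right[OF assms(1-4) assms(3)]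
      riemannian_metric_lincomb_right[OF assms(1-4) assms(4)]
    using riemannian_metric_sym[OF assms]
    by (simp add: power2_eq_square algebra_simps)
  finally show ?thesis by simp
qed

lemma riemannian_metric_cauchy_schwarz:
  assumes "riemannian_metric M g" "p \<in> points M" "u \<in> tangent M p" "v \<in> tangent M p"
  shows "\<bar>g p u v\<bar> \<le> sqrt (g p u u) * sqrt (g p v v)"
proof (cases "u = (\<lambda>_. 0) \<or> v = (\<lambda>_. 0)")
  case True
  then have "g p u v = 0"
    using riemannian_metric_zero_left[OF assms(1,2)] assms riemannian_metric_sym[OF assms] by auto
  then show ?thesis using riemannian_metric_nonneg[OF assms(1,2)] assms by simp
next
  case False
  \<comment> \<open>With these weights the right side of \<open>riemannian_metric_am_gm\<close>
    becomes \<open>2 * (a * b) * (a * b)\<close>, and the positive factor \<open>2 * (a * b)\<close>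
    cancels. Replacing \<open>b\<close> by \<open>-b\<close> gives the bound from below.\<close>
  define a b where "a = sqrt (g p v v)" and "b = sqrt (g p u u)"
  have pos: "g p u u > 0" "g p v v > 0"
    using False riemannian_metric_pos[OF assms(1,2)] assms(3,4) by blast+
  then have ab: "a > 0" "b > 0" "a\<^sup>2 = g p v v" "b\<^sup>2 = g p u u" by (auto simp: a_def b_def)
  have eq: "a\<^sup>2 * b\<^sup>2 + b\<^sup>2 * a\<^sup>2 = 2 * (a * b) * (a * b)"
    by (simp add: power2_eq_square)
  have "2 * (a * b) * g p u v \<le> 2 * (a * b) * (a * b)"
    using riemannian_metric_am_gm[OF assms, of a b] unfolding ab(3,4)[symmetric] eq .
  moreover have "2 * (a * - b) * g p u v \<le> 2 * (a * b) * (a * b)"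
    using riemannian_metric_am_gm[OF assms, of a "-b"] unfolding ab(3,4)[symmetric] power2_minus eq .
  then have "2 * (a * b) * (- g p u v) \<le> 2 * (a * b) * (a * b)"
    by (simp only: mult_minus_left mult_minus_right)
  moreover have "2 * (a * b) > 0" using ab(1,2) by simp
  ultimately have "g p u v \<le> a * b" "- g p u v \<le> a * b"
    using mult_left_le_imp_le[of "2 * (a * b)" "g p u v" "a * b"]
      mult_left_le_imp_le[of "2 * (a * b)" "- g p u v" "a * b"] by blast+
  then show ?thesis by (simp add: a_def b_def mult.commute)
qed

end

section \<open>The Kaehler form and its expression in charts\<close>

locale kaehler =
  fixes M :: "('m, 'k::euclidean_space) mfd" and J :: "('m, 'k) endo" and g :: "('m, 'k) metric"
  assumes kaehler: "kaehler_manifold M J g"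
begin

lemma smooth_manifold: "smooth_manifold M"
  using kaehler by (simp add: kaehler_manifold_def riemannian_manifold_def)

lemma metric: "riemannian_metric M g"
  using kaehler by (simp add: kaehler_manifold_def riemannian_manifold_def)

sublocale charted_space M
  by (rule smooth_manifold_imp_charted_space[OF smooth_manifold])

lemma acs: "almost_complex_structure M J"
  using kaehler by (simp add: kaehler_manifold_def)

lemma J_tangent: "p \<in> points M \<Longrightarrow> u \<in> tangent M p \<Longrightarrow> J p u \<in> tangent M p"
  using acs unfolding almost_complex_structure_def by blast

lemma J_J: "p \<in> points M \<Longrightarrow> u \<in> tangent M p \<Longrightarrow> J p (J p u) = (\<lambda>c. - u c)"
  using acs unfolding almost_complex_structure_def by blast

lemma J_lincomb:
  "p \<in> points M \<Longrightarrow> u \<in> tangent M p \<Longrightarrow> v \<in> tangent M p \<Longrightarrow>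
    J p (lincomb a u b v) = lincomb a (J p u) b (J p v)"
  using acs unfolding almost_complex_structure_def by blast

lemma J_isometry:
  "p \<in> points M \<Longrightarrow> u \<in> tangent M p \<Longrightarrow> v \<in> tangent M p \<Longrightarrow> g p (J p u) (J p v) = g p u v"
  using kaehler unfolding kaehler_manifold_def by blast

definition form :: "'m \<Rightarrow> ('m, 'k) tvec \<Rightarrow> ('m, 'k) tvec \<Rightarrow> real" where
  "form p u v = g p (J p u) v"

text \<open>\<open>J\<close> is an isometry with square \<open>-1\<close>, so
  \<open>g(Ju, v) = g(JJu, Jv) = -g(u, Jv)\<close>.\<close>

lemma form_skew:
  assumes "p \<in> points M" "u \<in> tangent M p" "v \<in> tangent M p"
  shows "form p u v = - form p v u"
proof -
  have neg: "(\<lambda>c. - u c) = lincomb (-1) u 0 u" by (simp add: lincomb_def)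
  have "form p u v = g p (J p (J p u)) (J p v)"
    using J_isometry[OF assms(1) J_tangent[OF assms(1,2)] assms(3)] by (simp add: form_def)
  also have "\<dots> = g p (lincomb (-1) u 0 u) (J p v)"
    using J_J[OF assms(1,2)] neg by simp
  also have "\<dots> = - g p u (J p v)"
    using riemannian_metric_lincomb_left[OF metric assms(1,2,2) J_tangent[OF assms(1,3)], of "-1" 0] by simp
  also have "\<dots> = - form p v u"
    using riemannian_metric_sym[OF metric assms(1,2) J_tangent[OF assms(1,3)]] by (simp add: form_def)
  finally show ?thesis .
qed

lemma form_lincomb_left:
  assumes "p \<in> points M" "u \<in> tangent M p" "v \<in> tangent M p" "w \<in> tangent M p"
  shows "form p (lincomb a u b v) w = a * form p u w + b * form p v w"
  using riemannian_metric_lincomb_left[OF metric assms(1) J_tangent[OF assms(1,2)] J_tangent[OF assms(1,3)] assms(4)]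
    J_lincomb[OF assms(1-3)]
  by (simp add: form_def)

text \<open>In another chart \<open>c\<close> the components are a derivative of the transition map
  from \<open>d\<close> to \<open>c\<close>, evaluated along the inverse transition. Smoothness
  makes the axioms for the metric, \<open>J\<close> and the connection applicable to coordinate
  fields.\<close>

lemma smooth_coord_vec:
  assumes d: "d \<in> atlas M"
  shows "smooth_vfield_on M (\<lambda>q. coord_vec M d q u) (cdom d)"
  unfolding smooth_vfield_on_def
proof (intro conjI ballI)
  show "openin (mtop M) (cdom d)" by (rule openin_cdom[OF d])
  show "coord_vec M d q u \<in> tangent M q" if "q \<in> cdom d" for q
    using that d by (intro coord_vec_tangent) (simp add: charts_at_def)
  fix c assume c: "c \<in> atlas M"
  have smooth: "smooth_on (cmap e' \<circ> cinv e) (cmap e ` (cdom e \<inter> cdom e'))"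
    if "e \<in> atlas M" "e' \<in> atlas M" for e e'
    using smooth_manifold that unfolding smooth_manifold_def by blast
  have "smooth_on (\<lambda>x. fd (cmap c \<circ> cinv d) ((cmap d \<circ> cinv c) x) u) (cmap c ` (cdom c \<inter> cdom d))"
  proof (rule smooth_on_compose[where f = "\<lambda>y. fd (cmap c \<circ> cinv d) y u", OF open_overlap[OF c d] open_overlap[OF d c]])
    show "(cmap d \<circ> cinv c) ` cmap c ` (cdom c \<inter> cdom d) \<subseteq> cmap d ` (cdom d \<inter> cdom c)"
      using cinv_cmap[OF c] by auto
  qed (rule smooth_on_fd[OF smooth[OF d c]] smooth[OF c d])+
  then have "smooth_on (\<lambda>x. coord_vec M d (cinv c x) u c) (cmap c ` (cdom c \<inter> cdom d))"
    by (rule smooth_on_cong[OF open_overlap[OF c d]])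
      (use c d cinv_cmap[OF c] in \<open>auto simp: coord_vec_def charts_at_def\<close>)
  then show "smooth_on (\<lambda>x. coord_vec M d (cinv c x) u c) (cmap c ` (cdom d \<inter> cdom c))"
    by (simp add: Int_commute)
qed

text \<open>The form as a family of bilinear forms on the model space, ready to play the role of
  \<open>\<Omega>\<close> in \<open>pullback_closed_form\<close>.\<close>

definition chart_form :: "('m, 'k) chart \<Rightarrow> 'k \<Rightarrow> 'k \<Rightarrow> 'k \<Rightarrow> real" where
  "chart_form d x u v = form (cinv d x) (coord_vec M d (cinv d x) u) (coord_vec M d (cinv d x) v)"

lemma chart_form_at:
  "d \<in> charts_at M p \<Longrightarrow> chart_form d (cmap d p) u v = form p (coord_vec M d p u) (coord_vec M d p v)"
  by (simp add: chart_form_def cinv_cmap_at)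

lemma chart_form_lincomb_left:
  assumes "d \<in> charts_at M p"
  shows "chart_form d (cmap d p) (a *\<^sub>R u + b *\<^sub>R v) w
    = a * chart_form d (cmap d p) u w + b * chart_form d (cmap d p) v w"
  using form_lincomb_left[OF charts_at_points[OF assms] coord_vec_tangent[OF assms]
      coord_vec_tangent[OF assms] coord_vec_tangent[OF assms]]
  by (simp add: chart_form_at[OF assms] coord_vec_linear[OF assms])

lemma chart_form_skew:
  assumes "d \<in> charts_at M p"
  shows "chart_form d (cmap d p) u v = - chart_form d (cmap d p) v u"
  unfolding chart_form_at[OF assms]
  by (rule form_skew[OF charts_at_points[OF assms] coord_vec_tangent[OF assms] coord_vec_tangent[OF assms]])

lemma linear_chart_form_left:
  assumes "d \<in> charts_at M p"
  shows "linear (\<lambda>u. chart_form d (cmap d p) u v)"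
proof
  show "chart_form d (cmap d p) (u + w) v = chart_form d (cmap d p) u v + chart_form d (cmap d p) w v" for u w
    using chart_form_lincomb_left[OF assms, of 1 u 1 w v] by simp
  show "chart_form d (cmap d p) (r *\<^sub>R u) v = r *\<^sub>R chart_form d (cmap d p) u v" for r u
    using chart_form_lincomb_left[OF assms, of r u 0 u v] by simp
qed

lemma linear_chart_form_right:
  assumes "d \<in> charts_at M p"
  shows "linear (chart_form d (cmap d p) u)"
proof -
  have "chart_form d (cmap d p) u = (\<lambda>v. - chart_form d (cmap d p) v u)"
    by (rule ext) (rule chart_form_skew[OF assms])
  then show ?thesis
    using linear_compose_neg[OF linear_chart_form_left[OF assms, of u]] by simp
qed

lemma smooth_metric:
  "smooth_vfield_on M X U \<Longrightarrow> smooth_vfield_on M Y U \<Longrightarrow> smooth_fun_on M (\<lambda>p. g p (X p) (Y p)) U"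
  using metric unfolding riemannian_metric_def by blast

lemma smooth_J_field: "smooth_vfield_on M X U \<Longrightarrow> smooth_vfield_on M (\<lambda>p. J p (X p)) U"
  using acs unfolding almost_complex_structure_def by blast

lemma chart_form_comp:
  "(\<lambda>x. chart_form d x u v) = (\<lambda>q. g q (J q (coord_vec M d q u)) (coord_vec M d q v)) \<circ> cinv d"
  by (auto simp: chart_form_def form_def)

lemma chart_form_differentiable:
  assumes "d \<in> charts_at M p"
  shows "(\<lambda>x. chart_form d x u v) differentiable (at (cmap d p))"
proof -
  have d: "d \<in> atlas M" "p \<in> cdom d" using assms by (auto simp: charts_at_def)
  have "smooth_fun_on M (\<lambda>q. g q (J q (coord_vec M d q u)) (coord_vec M d q v)) (cdom d)"
    by (intro smooth_metric smooth_J_field smooth_coord_vec d)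
  then have "smooth_on (\<lambda>x. chart_form d x u v) (cmap d ` (cdom d \<inter> cdom d))"
    using d unfolding smooth_fun_on_def chart_form_comp by blast
  then show ?thesis by (rule smooth_on_imp_differentiable) (use d in auto)
qed

text \<open>Let \<open>N u v\<close> be the covariant derivative of the coordinate field of
  \<open>v\<close> in direction \<open>u\<close>. Compatibility with the metric and parallelism of
  \<open>J\<close> express the derivative of \<open>\<omega>(u, v)\<close> along \<open>w\<close> as
  \<open>\<omega>(N w u, v) - \<omega>(N w v, u)\<close>. As \<open>N\<close> is symmetric, the
  cyclic sum cancels.\<close>

lemma chart_form_closed:
  assumes p: "d \<in> charts_at M p"
  shows "fd (\<lambda>x. chart_form d x u v) (cmap d p) w + fd (\<lambda>x. chart_form d x v w) (cmap d p) u
    + fd (\<lambda>x. chart_form d x w u) (cmap d p) v = 0"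
proof -
  have d: "d \<in> atlas M" "p \<in> cdom d" and pM: "p \<in> points M"
    using p charts_at_points by (auto simp: charts_at_def)
  obtain D where D: "affine_connection M D" "torsion_free M D" "metric_connection M g D" "parallel_endo M D J"
    using kaehler unfolding kaehler_manifold_def levi_civita_def by blast
  define E where "E = (\<lambda>u q. coord_vec M d q u)"
  define N where "N = (\<lambda>u v. D p (E u p) (E v))"
  have smE: "smooth_vfield_on M (E u) (cdom d)" for u
    unfolding E_def by (rule smooth_coord_vec[OF d(1)])
  have tE: "E u p \<in> tangent M p" for u
    unfolding E_def by (rule coord_vec_tangent[OF p])
  have tN: "N u v \<in> tangent M p" for u v
    using D(1) smE d(2) tE unfolding affine_connection_def N_def by blast
  \<comment> \<open>In its own chart a coordinate field has constant components; this kills the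
    bracket, and torsion-freeness then yields the symmetry of \<open>N\<close>.\<close>
  have const: "fd (\<lambda>x. E v (cinv d x) d) (cmap d p) = (\<lambda>_. 0)" for v
  proof -
    have "((\<lambda>x. v) has_derivative (\<lambda>_. 0)) (at (cmap d p))" by simp
    then have "((\<lambda>x. E v (cinv d x) d) has_derivative (\<lambda>_. 0)) (at (cmap d p))"
    proof (rule has_derivative_transform_within_open[OF _ open_chart_image[OF d(1)]])
      show "v = E v (cinv d x) d" if "x \<in> cmap d ` cdom d" for x
        using that d cinv_cmap[OF d(1)] by (auto simp: E_def coord_vec_self charts_at_def)
    qed (use d in auto)
    then show ?thesis by (rule fd_eqI)
  qed
  have symN: "N u v = N v u" for u v
  proof (rule tangent_eqI[OF tN tN p])
    have "lincomb 1 (N u v) (-1) (N v u) = lie_bracket M (E u) (E v) p"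
      using D(2) smE d(2) unfolding torsion_free_def N_def by blast
    moreover have "lie_bracket M (E u) (E v) p d = 0"
      using p by (simp add: lie_bracket_def const)
    ultimately have "lincomb 1 (N u v) (-1) (N v u) d = 0" by simp
    then show "N u v d = N v u d" by (simp add: lincomb_def)
  qed
  have der: "fd (\<lambda>x. chart_form d x u v) (cmap d p) w
      = form p (N w u) (E v p) - form p (N w v) (E u p)" for u v w
  proof -
    have smJ: "smooth_vfield_on M (\<lambda>q. J q (E u q)) (cdom d)" by (rule smooth_J_field[OF smE])
    have "fd (\<lambda>x. chart_form d x u v) (cmap d p) w = dir_deriv M p (E w p) (\<lambda>q. g q (J q (E u q)) (E v q))"
      using dir_deriv_eq[OF p tE, of "\<lambda>q. g q (J q (E u q)) (E v q)" w]
        chart_form_differentiable[OF p, of u v] coord_vec_self[OF p]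
      by (simp only: chart_form_comp E_def)
    also have "\<dots> = g p (D p (E w p) (\<lambda>q. J q (E u q))) (E v p) + g p (J p (E u p)) (N w v)"
      using D(3) smJ smE d(2) tE unfolding metric_connection_def N_def by blast
    also have "D p (E w p) (\<lambda>q. J q (E u q)) = J p (N w u)"
      using D(4) smE d(2) tE unfolding parallel_endo_def N_def by blast
    also have "g p (J p (N w u)) (E v p) + g p (J p (E u p)) (N w v)
        = form p (N w u) (E v p) - form p (N w v) (E u p)"
      using form_skew[OF pM tE tN, of u w v] by (simp add: form_def)
    finally show ?thesis .
  qed
  show ?thesis
    unfolding der using symN[of w u] symN[of w v] symN[of u v] by simp
qed

text \<open>
  The pullback of the Kaehler form along \<open>F\<close> is closed, and under the two hypotheses only one term
  of its exterior derivative on the coordinate fields \<open>a\<close>, \<open>b\<close>, \<open>e\<close> survives.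
\<close>

lemma pullback_form_derivative_zero:
  fixes N :: "('n, 'e::euclidean_space) mfd"
  assumes N: "charted_space N" and F: "smooth_map N M F" and c: "c \<in> charts_at N p"
    and ab: "\<And>q. q \<in> cdom c \<Longrightarrow>
      form (F q) (diff_map N M F q (coord_vec N c q a)) (diff_map N M F q (coord_vec N c q b)) = 0"
    and ae: "\<And>q. q \<in> cdom c \<Longrightarrow>
      form (F q) (diff_map N M F q (coord_vec N c q a)) (diff_map N M F q (coord_vec N c q e)) = 0"
  defines "\<omega> \<equiv> \<lambda>u v x. form (F (cinv c x)) (diff_map N M F (cinv c x) (coord_vec N c (cinv c x) u))
      (diff_map N M F (cinv c x) (coord_vec N c (cinv c x) v))"
  shows "\<omega> b e differentiable (at (cmap c p))" and "fd (\<omega> b e) (cmap c p) a = 0"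
proof -
  interpret N: charted_space N by fact
  have pN: "p \<in> points N" by (rule N.charts_at_points[OF c])
  obtain d where d: "d \<in> charts_at M (F p)"
    using some_chart_at[OF smooth_map_points[OF F pN]] by blast
  have atl: "c \<in> atlas N" "d \<in> atlas M" "p \<in> cdom c" "F p \<in> cdom d"
    using c d by (auto simp: charts_at_def)
  define W where "W = cmap c ` {q \<in> cdom c. F q \<in> cdom d}"
  define G where "G = cmap d \<circ> F \<circ> cinv c"
  define T where "T = cmap d ` cdom d"
  have W: "open W" "cmap c p \<in> W" and G: "smooth_on G W"
    using smooth_map_local[OF N charted_space_axioms F atl(1,2)] atl by (auto simp: W_def G_def)
  have T: "open T" unfolding T_def by (rule open_chart_image[OF atl(2)])
  have GW: "G ` W \<subseteq> T" using N.cinv_cmap[OF atl(1)] by (auto simp: W_def G_def T_def)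
  \<comment> \<open>In coordinates \<open>F\<close> becomes \<open>G\<close>, and the differential
    of \<open>F\<close> on a coordinate field becomes a directional derivative of \<open>G\<close>;
    so \<open>\<omega>\<close> has the shape required by
    \<open>pullback_closed_form\<close>.\<close>
  have \<omega>: "\<omega> u v x = chart_form d (G x) (fd G x u) (fd G x v)" if x: "x \<in> W" for u v x
  proof -
    obtain q where q: "q \<in> cdom c" "F q \<in> cdom d" "x = cmap c q" using x by (auto simp: W_def)
    have cq: "c \<in> charts_at N q" and dq: "d \<in> charts_at M (F q)"
      using q atl by (auto simp: charts_at_def)
    have inv: "cinv c x = q" using N.cinv_cmap_at[OF cq] q by simp
    have Gx: "G x = cmap d (F q)" by (simp add: G_def inv)
    have "coord_vec M d (F q) (fd G x u) = diff_map N M F q (coord_vec N c q u)" for u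
    proof -
      have "diff_map N M F q (coord_vec N c q u) d = fd G x u"
        using N.diff_map_eq[OF cq N.coord_vec_tangent[OF cq] dq
            smooth_map_differentiable[OF N charted_space_axioms F cq dq]]
        by (simp add: N.coord_vec_self[OF cq] G_def q(3))
      then show ?thesis
        using coord_vec_tangent_eq[OF diff_map_tangent[OF N charted_space_axioms F
              N.charts_at_points[OF cq] N.coord_vec_tangent[OF cq]] dq] by metis
    qed
    then show ?thesis
      unfolding Gx chart_form_at[OF dq] by (simp add: \<omega>_def inv)
  qed
  have at: "\<exists>q. d \<in> charts_at M q \<and> y = cmap d q" if "y \<in> T" for y
    using that atl by (auto simp: T_def charts_at_def)
  note closed = pullback_closed_form[where \<Omega> = "chart_form d" and G = G, OF W(1,2) T GW G]
  have dif: "(\<lambda>y. chart_form d (G y) (fd G y u) (fd G y v)) differentiable (at (cmap c p))" for u v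
    by (rule closed(1))
      (use at linear_chart_form_left linear_chart_form_right chart_form_differentiable
        chart_form_skew chart_form_closed in blast)+
  have cyc: "fd (\<lambda>y. chart_form d (G y) (fd G y b) (fd G y e)) (cmap c p) a
      + fd (\<lambda>y. chart_form d (G y) (fd G y e) (fd G y a)) (cmap c p) b
      + fd (\<lambda>y. chart_form d (G y) (fd G y a) (fd G y b)) (cmap c p) e = 0"
    by (rule closed(2))
      (use at linear_chart_form_left linear_chart_form_right chart_form_differentiable
        chart_form_skew chart_form_closed in blast)+
  \<comment> \<open>Orthogonality holds on the whole chart domain, not just at \<open>p\<close>, so
    derivatives in every direction vanish, including those along \<open>b\<close> and
    \<open>e\<close>.\<close>
  have zero: "fd (\<lambda>y. chart_form d (G y) (fd G y u) (fd G y v)) (cmap c p) = (\<lambda>_. 0)"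
    if "\<And>x. x \<in> W \<Longrightarrow> chart_form d (G x) (fd G x u) (fd G x v) = 0" for u v
  proof -
    have "((\<lambda>y. 0::real) has_derivative (\<lambda>_. 0)) (at (cmap c p))" by simp
    then have "((\<lambda>y. chart_form d (G y) (fd G y u) (fd G y v)) has_derivative (\<lambda>_. 0)) (at (cmap c p))"
      by (rule has_derivative_transform_within_open[OF _ W]) (use that in simp)
    then show ?thesis by (rule fd_eqI)
  qed
  have "\<omega> a b x = 0" "\<omega> a e x = 0" if "x \<in> W" for x
    using that ab ae N.cinv_cmap[OF atl(1)] by (auto simp: W_def \<omega>_def)
  \<comment> \<open>The cyclic formula contains the pair \<open>e\<close>, \<open>a\<close>, whereas
    the hypothesis concerns \<open>a\<close>, \<open>e\<close>.\<close>
  moreover have "chart_form d (G x) (fd G x e) (fd G x a) = - chart_form d (G x) (fd G x a) (fd G x e)"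
    if "x \<in> W" for x
  proof -
    have "G x \<in> T" using GW that by blast
    then obtain q where q: "d \<in> charts_at M q" "G x = cmap d q" using at by blast
    show ?thesis unfolding q(2) by (rule chart_form_skew[OF q(1)])
  qed
  ultimately have "fd (\<lambda>y. chart_form d (G y) (fd G y e) (fd G y a)) (cmap c p) = (\<lambda>_. 0)"
    "fd (\<lambda>y. chart_form d (G y) (fd G y a) (fd G y b)) (cmap c p) = (\<lambda>_. 0)"
    using \<omega> by (auto intro!: zero)
  then have 0: "fd (\<lambda>y. chart_form d (G y) (fd G y b) (fd G y e)) (cmap c p) a = 0"
    using cyc by simp
  have cong: "\<And>x. x \<in> W \<Longrightarrow> chart_form d (G x) (fd G x b) (fd G x e) = \<omega> b e x"
    using \<omega> by simp
  show "\<omega> b e differentiable (at (cmap c p))" "fd (\<omega> b e) (cmap c p) a = 0"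
    using fd_cong_open[OF dif W cong] 0 by simp_all
qed

end

section \<open>Biwarped product submanifolds\<close>

text \<open>On a coordinate ball, which is convex, \<open>\<phi>\<close> is constant. Hence every
  condition on the value of \<open>\<phi>\<close> cuts out an open set; a level set and its
  complement are both open, and connectedness leaves only one level.\<close>

lemma connected_zero_derivative_constant:
  fixes M :: "('a, 'e::euclidean_space) mfd" and \<phi> :: "'a \<Rightarrow> real"
  assumes "smooth_manifold M" "connected_space (mtop M)"
    and der: "\<And>c p. c \<in> charts_at M p \<Longrightarrow> ((\<phi> \<circ> cinv c) has_derivative (\<lambda>_. 0)) (at (cmap c p))"
  shows "\<phi> constant_on points M"
proof -
  interpret charted_space M by (rule smooth_manifold_imp_charted_space[OF assms(1)])
  have op: "openin (mtop M) {x \<in> points M. P (\<phi> x)}" for P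
  proof (subst openin_subopen, intro ballI)
    fix p assume p: "p \<in> {x \<in> points M. P (\<phi> x)}"
    then obtain c where c: "c \<in> charts_at M p" using some_chart_at by blast
    then have atl: "c \<in> atlas M" "p \<in> cdom c" by (auto simp: charts_at_def)
    have "cmap c p \<in> cmap c ` cdom c" using atl by blast
    then obtain r where r: "r > 0" "ball (cmap c p) r \<subseteq> cmap c ` cdom c"
      using open_chart_image[OF atl(1)] open_contains_ball by blast
    have const: "(\<phi> \<circ> cinv c) y = (\<phi> \<circ> cinv c) (cmap c p)" if "y \<in> ball (cmap c p) r" for y
    proof (rule has_derivative_zero_unique[where f = "\<phi> \<circ> cinv c", OF convex_ball])
      fix z assume "z \<in> ball (cmap c p) r"
      then obtain q where "q \<in> cdom c" "z = cmap c q" using r by blast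
      then show "((\<phi> \<circ> cinv c) has_derivative (\<lambda>h. 0)) (at z within ball (cmap c p) r)"
        using der[of c q] atl(1) has_derivative_at_withinI by (auto simp: charts_at_def)
    qed (use that r in auto)
    define V where "V = {q \<in> topspace (subtopology (mtop M) (cdom c)). cmap c q \<in> ball (cmap c p) r}"
    have hom: "homeomorphic_map (subtopology (mtop M) (cdom c)) (top_of_set (cmap c ` cdom c)) (cmap c)"
      using assms(1) atl(1) unfolding smooth_manifold_def by blast
    have "openin (top_of_set (cmap c ` cdom c)) (ball (cmap c p) r)"
      using r(2) by (simp add: open_subset)
    then have "openin (subtopology (mtop M) (cdom c)) V"
      unfolding V_def using homeomorphic_imp_continuous_map[OF hom] openin_continuous_map_preimage by blast
    then have "openin (mtop M) V"
      using openin_cdom[OF atl(1)] by (simp add: openin_open_subtopology)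
    moreover have "p \<in> V" using atl r(1) p by (simp add: V_def)
    moreover have "V \<subseteq> {x \<in> points M. P (\<phi> x)}"
    proof
      fix q assume "q \<in> V"
      then have q: "q \<in> points M" "q \<in> cdom c" "cmap c q \<in> ball (cmap c p) r" by (auto simp: V_def)
      then show "q \<in> {x \<in> points M. P (\<phi> x)}"
        using const[OF q(3)] p cinv_cmap[OF atl(1)] atl by auto
    qed
    ultimately show "\<exists>T. openin (mtop M) T \<and> p \<in> T \<and> T \<subseteq> {x \<in> points M. P (\<phi> x)}" by blast
  qed
  obtain x0 where x0: "x0 \<in> points M" using assms(1) unfolding smooth_manifold_def by blast
  define S where "S = {x \<in> points M. \<phi> x = \<phi> x0}"
  have "points M - S = {x \<in> points M. \<phi> x \<noteq> \<phi> x0}" by (auto simp: S_def)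
  then have "openin (mtop M) S" "closedin (mtop M) S"
    using op[of "\<lambda>t. t = \<phi> x0"] op[of "\<lambda>t. t \<noteq> \<phi> x0"] unfolding closedin_def by (auto simp: S_def)
  moreover have "x0 \<in> S" using x0 by (simp add: S_def)
  ultimately have "S = points M" using assms(2) unfolding connected_space_clopen_in by blast
  then show ?thesis unfolding constant_on_def S_def by blast
qed

text \<open>Cosine decreases on \<open>[0, pi]\<close>, so the cosine of an infimum of angles is the
  least upper bound of their cosines. Unlike the angles, these cosines behave well under scaling.
  The bounds on \<open>\<theta>\<close> allow recovering it from its cosine.\<close>

lemma cos_INF_arccos:
  assumes "A \<noteq> {}" "\<And>w. w \<in> A \<Longrightarrow> \<bar>r w\<bar> \<le> 1" "\<theta> = (INF w\<in>A. arccos (r w))"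
  shows "0 \<le> \<theta>" "\<theta> \<le> pi" "\<And>w. w \<in> A \<Longrightarrow> r w \<le> cos \<theta>"
    "\<And>s. (\<And>w. w \<in> A \<Longrightarrow> r w \<le> s) \<Longrightarrow> cos \<theta> \<le> s"
proof -
  have bnd: "0 \<le> arccos (r w)" "arccos (r w) \<le> pi" if "w \<in> A" for w
    using arccos_bounded assms(2)[OF that] by (auto simp: abs_le_iff)
  have bdd: "bdd_below ((\<lambda>w. arccos (r w)) ` A)" using bnd by (auto intro!: bdd_belowI2[of _ 0])
  show "0 \<le> \<theta>" unfolding assms(3) using assms(1) bnd by (intro cINF_greatest) auto
  have le: "\<theta> \<le> arccos (r w)" if "w \<in> A" for w
    unfolding assms(3) using that bdd by (rule cINF_lower[rotated])
  show "\<theta> \<le> pi" using assms(1) le bnd by (meson ex_in_conv order_trans)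
  show "r w \<le> cos \<theta>" if w: "w \<in> A" for w
  proof -
    have "cos (arccos (r w)) \<le> cos \<theta>"
      by (rule cos_monotone_0_pi_le) (use \<open>0 \<le> \<theta>\<close> le[OF w] bnd[OF w] in auto)
    then show ?thesis using assms(2)[OF w] by (simp add: cos_arccos_abs)
  qed
  show "cos \<theta> \<le> s" if s: "\<And>w. w \<in> A \<Longrightarrow> r w \<le> s" for s
  proof (rule ccontr)
    assume "\<not> cos \<theta> \<le> s"
    then have "s < cos \<theta>" by simp
    \<comment> \<open>An element of \<open>A\<close> bounds \<open>s\<close> from below by -1, and
      \<open>s < cos \<theta>\<close> bounds it from above by 1, so that \<open>arccos s\<close> is
      meaningful.\<close>
    obtain w0 where "w0 \<in> A" using assms(1) by blast
    then have "-1 \<le> s" using s[of w0] assms(2)[of w0] by (auto simp: abs_le_iff)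
    moreover have "s \<le> 1" using \<open>s < cos \<theta>\<close> cos_le_one[of \<theta>] by linarith
    ultimately have s1: "\<bar>s\<bar> \<le> 1" by simp
    have "arccos s \<le> arccos (r w)" if "w \<in> A" for w
      by (rule arccos_le_arccos) (use s[of w] assms(2)[OF that] that s1 in auto)
    then have "arccos s \<le> \<theta>" unfolding assms(3) using assms(1) by (intro cINF_greatest)
    then have "cos \<theta> \<le> cos (arccos s)"
      using arccos_lbound[of s] \<open>\<theta> \<le> pi\<close> s1 by (intro cos_monotone_0_pi_le) auto
    then show False using \<open>s < cos \<theta>\<close> s1 by (simp add: cos_arccos_abs)
  qed
qed

lemma (in charted_space) coord_vec_zero: "d \<in> charts_at M p \<Longrightarrow> coord_vec M d p 0 = (\<lambda>_. 0)"
  by (rule tangent_eqI) (auto simp: coord_vec_tangent coord_vec_self intro!: zero_tangent charts_at_points)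

lemma (in charted_space) exists_nonzero_tangent:
  assumes "p \<in> points M"
  obtains v where "v \<in> tangent M p" "v \<noteq> (\<lambda>_. 0)"
proof
  let ?c = "some_chart M p" and ?b = "SOME b. b \<in> (Basis :: 'e set)"
  have c: "?c \<in> charts_at M p" by (rule some_chart_at[OF assms])
  show "coord_vec M ?c p ?b \<in> tangent M p" by (rule coord_vec_tangent[OF c])
  have "coord_vec M ?c p ?b ?c \<noteq> 0"
    unfolding coord_vec_self[OF c] using SOME_Basis nonzero_Basis by blast
  then show "coord_vec M ?c p ?b \<noteq> (\<lambda>_. 0)" by metis
qed

section \<open>Leaves and metric of a biwarped product in product charts\<close>

locale biwarped_kaehler_submanifold = kaehler M J g
  for M :: "('m, 'k::euclidean_space) mfd" and J :: "('m, 'k) endo" and g :: "('m, 'k) metric" +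
  fixes M0 :: "('a, 'e::euclidean_space) mfd" and g0 :: "('a, 'e) metric" and f1 :: "'a \<Rightarrow> real"
    and M1 :: "('b, 'f::euclidean_space) mfd" and g1 :: "('b, 'f) metric"
    and f2 :: "'a \<Rightarrow> real" and M2 :: "('c, 'h::euclidean_space) mfd" and g2 :: "('c, 'h) metric"
    and F :: "'a \<times> 'b \<times> 'c \<Rightarrow> 'm"
  assumes biwarped: "biwarped_submanifold M g M0 g0 f1 M1 g1 f2 M2 g2 F"
begin

lemma factors: "riemannian_manifold M0 g0" "riemannian_manifold M1 g1" "riemannian_manifold M2 g2"
  and warping: "warping_function M0 f1" "warping_function M0 f2"
  and isometric: "isometric_immersion (prod3 M0 M1 M2) (biwarped_metric M0 g0 f1 M1 g1 f2 M2 g2) M g F"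
  using biwarped unfolding biwarped_submanifold_def by blast+

lemma smooth0: "smooth_manifold M0" and metric0: "riemannian_metric M0 g0"
  and smooth1: "smooth_manifold M1" and metric1: "riemannian_metric M1 g1"
  and smooth2: "smooth_manifold M2" and metric2: "riemannian_metric M2 g2"
  using factors unfolding riemannian_manifold_def by blast+

sublocale M0: charted_space M0 by (rule smooth_manifold_imp_charted_space[OF smooth0])
sublocale M1: charted_space M1 by (rule smooth_manifold_imp_charted_space[OF smooth1])
sublocale M2: charted_space M2 by (rule smooth_manifold_imp_charted_space[OF smooth2])

abbreviation P :: "('a \<times> 'b \<times> 'c, 'e \<times> 'f \<times> 'h) mfd" where
  "P \<equiv> prod3 M0 M1 M2"

sublocale P: charted_space P
  by (intro charted_space_prod M0.charted_space_axioms M1.charted_space_axioms M2.charted_space_axioms)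

lemma smooth_F: "smooth_map P M F"
  using isometric unfolding isometric_immersion_def immersion_def by blast

definition chart3 :: "('a, 'e) chart \<Rightarrow> ('b, 'f) chart \<Rightarrow> ('c, 'h) chart \<Rightarrow> ('a \<times> 'b \<times> 'c, 'e \<times> 'f \<times> 'h) chart" where
  "chart3 c0 c1 c2 = prod_chart c0 (prod_chart c1 c2)"

lemma chart3_at:
  "c0 \<in> charts_at M0 x \<Longrightarrow> c1 \<in> charts_at M1 y \<Longrightarrow> c2 \<in> charts_at M2 z \<Longrightarrow>
    chart3 c0 c1 c2 \<in> charts_at P (x, y, z)"
  unfolding chart3_def charts_at_prod by blast

lemma cmap_chart3: "cmap (chart3 c0 c1 c2) (x, y, z) = (cmap c0 x, cmap c1 y, cmap c2 z)"
  by (simp add: chart3_def)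

lemma cdom_chart3: "cdom (chart3 c0 c1 c2) = cdom c0 \<times> cdom c1 \<times> cdom c2"
  by (simp add: chart3_def)

lemma cinv_chart3:
  assumes "c0 \<in> atlas M0" "c1 \<in> atlas M1" "c2 \<in> atlas M2"
    and "\<xi> \<in> cmap c0 ` cdom c0" "\<eta> \<in> cmap c1 ` cdom c1" "\<zeta> \<in> cmap c2 ` cdom c2"
  shows "cinv (chart3 c0 c1 c2) (\<xi>, \<eta>, \<zeta>) = (cinv c0 \<xi>, cinv c1 \<eta>, cinv c2 \<zeta>)"
proof -
  have inj: "inj_on (cmap (prod_chart c1 c2)) (cdom (prod_chart c1 c2))"
    unfolding cdom_prod_chart cmap_prod_chart
    by (rule map_prod_inj_on[OF M1.inj_on_cmap[OF assms(2)] M2.inj_on_cmap[OF assms(3)]])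
  have "(\<eta>, \<zeta>) \<in> cmap (prod_chart c1 c2) ` cdom (prod_chart c1 c2)"
    using assms(5,6) by (auto simp: map_prod_def)
  then show ?thesis
    unfolding chart3_def
    using cinv_prod_chart[OF M0.inj_on_cmap[OF assms(1)] inj assms(4)]
      cinv_prod_chart[OF M1.inj_on_cmap[OF assms(2)] M2.inj_on_cmap[OF assms(3)] assms(5,6)]
    by simp
qed

text \<open>One notation for all three factors: a vector tangent to a factor has a single coordinate
  block, and a fixed \<open>V\<close> gives a coordinate field of the product chart.\<close>

definition dF :: "'a \<times> 'b \<times> 'c \<Rightarrow> ('a, 'e) chart \<Rightarrow> ('b, 'f) chart \<Rightarrow> ('c, 'h) chart \<Rightarrow>
    'e \<times> 'f \<times> 'h \<Rightarrow> ('m, 'k) tvec" where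
  "dF p c0 c1 c2 V = diff_map P M F p (coord_vec P (chart3 c0 c1 c2) p V)"

abbreviation d0 :: "'a \<Rightarrow> 'b \<Rightarrow> 'c \<Rightarrow> ('a, 'e) tvec \<Rightarrow> ('m, 'k) tvec" where
  "d0 x y z \<equiv> diff_map M0 M (\<lambda>x. F (x, y, z)) x"

abbreviation d1 :: "'a \<Rightarrow> 'b \<Rightarrow> 'c \<Rightarrow> ('b, 'f) tvec \<Rightarrow> ('m, 'k) tvec" where
  "d1 x y z \<equiv> diff_map M1 M (\<lambda>y. F (x, y, z)) y"

abbreviation d2 :: "'a \<Rightarrow> 'b \<Rightarrow> 'c \<Rightarrow> ('c, 'h) tvec \<Rightarrow> ('m, 'k) tvec" where
  "d2 x y z \<equiv> diff_map M2 M (\<lambda>z. F (x, y, z)) z"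

context
  fixes x y z c0 c1 c2
  assumes c: "c0 \<in> charts_at M0 x" "c1 \<in> charts_at M1 y" "c2 \<in> charts_at M2 z"
begin

lemma atl: "c0 \<in> atlas M0" "c1 \<in> atlas M1" "c2 \<in> atlas M2" "x \<in> cdom c0" "y \<in> cdom c1" "z \<in> cdom c2"
  using c by (auto simp: charts_at_def)

lemma F_points: "F (x, y, z) \<in> points M"
  using smooth_map_points[OF smooth_F] P.charts_at_points[OF chart3_at[OF c]] by blast

lemma dF_tangent: "dF (x, y, z) c0 c1 c2 V \<in> tangent M (F (x, y, z))"
  unfolding dF_def
  by (rule diff_map_tangent[OF P.charted_space_axioms charted_space_axioms smooth_F
        P.charts_at_points[OF chart3_at[OF c]] P.coord_vec_tangent[OF chart3_at[OF c]]])

text \<open>The inclusion of a leaf is affine in product charts and its derivative inserts a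
  coordinate block. This links hypotheses about leaves to coordinate fields of the product.\<close>

lemma d0_eq: "u \<in> tangent M0 x \<Longrightarrow> d0 x y z u = dF (x, y, z) c0 c1 c2 (u c0, 0, 0)"
  unfolding dF_def
  by (rule diff_map_precompose[where j = "\<lambda>t. (t, y, z)" and A = "\<lambda>\<xi>. (\<xi>, cmap c1 y, cmap c2 z)" and L = "\<lambda>u. (u, 0, 0)",
        OF M0.charted_space_axioms P.charted_space_axioms charted_space_axioms smooth_F
        c(1) chart3_at[OF c] _ M0.open_chart_image[OF atl(1)]])
    (use atl cinv_chart3[OF atl(1-3)] M1.cinv_cmap[OF atl(2)] M2.cinv_cmap[OF atl(3)]
      in \<open>auto simp: cmap_chart3 zero_prod_def intro!: derivative_eq_intros\<close>)

lemma d1_eq: "u \<in> tangent M1 y \<Longrightarrow> d1 x y z u = dF (x, y, z) c0 c1 c2 (0, u c1, 0)"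
  unfolding dF_def
  by (rule diff_map_precompose[where j = "\<lambda>t. (x, t, z)" and A = "\<lambda>\<xi>. (cmap c0 x, \<xi>, cmap c2 z)" and L = "\<lambda>u. (0, u, 0)",
        OF M1.charted_space_axioms P.charted_space_axioms charted_space_axioms smooth_F
        c(2) chart3_at[OF c] _ M1.open_chart_image[OF atl(2)]])
    (use atl cinv_chart3[OF atl(1-3)] M0.cinv_cmap[OF atl(1)] M2.cinv_cmap[OF atl(3)]
      in \<open>auto simp: cmap_chart3 zero_prod_def intro!: derivative_eq_intros\<close>)

lemma d2_eq: "u \<in> tangent M2 z \<Longrightarrow> d2 x y z u = dF (x, y, z) c0 c1 c2 (0, 0, u c2)"
  unfolding dF_def
  by (rule diff_map_precompose[where j = "\<lambda>t. (x, y, t)" and A = "\<lambda>\<xi>. (cmap c0 x, cmap c1 y, \<xi>)" and L = "\<lambda>u. (0, 0, u)",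
        OF M2.charted_space_axioms P.charted_space_axioms charted_space_axioms smooth_F
        c(3) chart3_at[OF c] _ M2.open_chart_image[OF atl(3)]])
    (use atl cinv_chart3[OF atl(1-3)] M0.cinv_cmap[OF atl(1)] M1.cinv_cmap[OF atl(2)]
      in \<open>auto simp: cmap_chart3 zero_prod_def intro!: derivative_eq_intros\<close>)

text \<open>The three projections extract the coordinate blocks of \<open>V\<close> and
  \<open>W\<close>, so the isometry condition splits into three summands and vectors tangent to
  different factors are orthogonal.\<close>

lemma metric_dF:
  "g (F (x, y, z)) (dF (x, y, z) c0 c1 c2 V) (dF (x, y, z) c0 c1 c2 W)
    = g0 x (coord_vec M0 c0 x (fst V)) (coord_vec M0 c0 x (fst W))
      + (f1 x)\<^sup>2 * g1 y (coord_vec M1 c1 y (fst (snd V))) (coord_vec M1 c1 y (fst (snd W)))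
      + (f2 x)\<^sup>2 * g2 z (coord_vec M2 c2 z (snd (snd V))) (coord_vec M2 c2 z (snd (snd W)))"
proof -
  let ?p = "(x, y, z)" and ?c = "chart3 c0 c1 c2"
  let ?S = "(cmap c0 ` cdom c0) \<times> (cmap c1 ` cdom c1) \<times> (cmap c2 ` cdom c2)"
  note cp = chart3_at[OF c]
  have S: "open ?S" "cmap ?c ?p \<in> ?S"
    using atl by (auto simp: cmap_chart3 intro!: open_Times M0.open_chart_image M1.open_chart_image M2.open_chart_image)
  have cinv: "cinv ?c \<xi> = (cinv c0 (fst \<xi>), cinv c1 (fst (snd \<xi>)), cinv c2 (snd (snd \<xi>)))" if "\<xi> \<in> ?S" for \<xi>
    using that cinv_chart3[OF atl(1-3)] by auto
  have proj: "diff_map P M0 fst ?p (coord_vec P ?c ?p V) = coord_vec M0 c0 x (fst V)"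
    "diff_map P M1 (fst \<circ> snd) ?p (coord_vec P ?c ?p V) = coord_vec M1 c1 y (fst (snd V))"
    "diff_map P M2 (snd \<circ> snd) ?p (coord_vec P ?c ?p V) = coord_vec M2 c2 z (snd (snd V))" for V
  proof -
    note tv = P.coord_vec_tangent[OF cp, of V]
    show "diff_map P M0 fst ?p (coord_vec P ?c ?p V) = coord_vec M0 c0 x (fst V)"
      using diff_map_linear_in_charts[OF P.charted_space_axioms M0.charted_space_axioms cp _ tv S,
          where \<pi> = fst and e = c0 and L = fst] cinv c
      by (simp add: bounded_linear_fst cmap_chart3 P.coord_vec_self[OF cp])
    show "diff_map P M1 (fst \<circ> snd) ?p (coord_vec P ?c ?p V) = coord_vec M1 c1 y (fst (snd V))"
      using diff_map_linear_in_charts[OF P.charted_space_axioms M1.charted_space_axioms cp _ tv S,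
          where \<pi> = "fst \<circ> snd" and e = c1 and L = "\<lambda>\<xi>. fst (snd \<xi>)"] cinv c
      by (simp add: bounded_linear_fst_comp bounded_linear_snd cmap_chart3 P.coord_vec_self[OF cp])
    show "diff_map P M2 (snd \<circ> snd) ?p (coord_vec P ?c ?p V) = coord_vec M2 c2 z (snd (snd V))"
      using diff_map_linear_in_charts[OF P.charted_space_axioms M2.charted_space_axioms cp _ tv S,
          where \<pi> = "snd \<circ> snd" and e = c2 and L = "\<lambda>\<xi>. snd (snd \<xi>)"] cinv c
      by (simp add: bounded_linear_snd_comp bounded_linear_snd cmap_chart3 P.coord_vec_self[OF cp])
  qed
  have "g (F ?p) (dF ?p c0 c1 c2 V) (dF ?p c0 c1 c2 W)
      = biwarped_metric M0 g0 f1 M1 g1 f2 M2 g2 ?p (coord_vec P ?c ?p V) (coord_vec P ?c ?p W)"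
    using isometric P.charts_at_points[OF cp] P.coord_vec_tangent[OF cp]
    unfolding isometric_immersion_def pullback_metric_def dF_def by blast
  also have "\<dots> = g0 x (coord_vec M0 c0 x (fst V)) (coord_vec M0 c0 x (fst W))
      + (f1 x)\<^sup>2 * g1 y (coord_vec M1 c1 y (fst (snd V))) (coord_vec M1 c1 y (fst (snd W)))
      + (f2 x)\<^sup>2 * g2 z (coord_vec M2 c2 z (snd (snd V))) (coord_vec M2 c2 z (snd (snd W)))"
    unfolding biwarped_metric_def pullback_metric_def proj by simp
  finally show ?thesis .
qed

lemma zero_metrics:
  "w \<in> tangent M0 x \<Longrightarrow> g0 x (\<lambda>_. 0) w = 0" "w \<in> tangent M0 x \<Longrightarrow> g0 x w (\<lambda>_. 0) = 0"
  "w' \<in> tangent M1 y \<Longrightarrow> g1 y (\<lambda>_. 0) w' = 0" "w' \<in> tangent M1 y \<Longrightarrow> g1 y w' (\<lambda>_. 0) = 0"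
  "w'' \<in> tangent M2 z \<Longrightarrow> g2 z (\<lambda>_. 0) w'' = 0"
proof -
  note p = M0.charts_at_points[OF c(1)] M1.charts_at_points[OF c(2)] M2.charts_at_points[OF c(3)]
  show 0: "g0 x (\<lambda>_. 0) w = 0" if "w \<in> tangent M0 x" for w
    by (rule M0.riemannian_metric_zero_left[OF metric0 p(1) that])
  show 1: "g1 y (\<lambda>_. 0) w' = 0" if "w' \<in> tangent M1 y" for w'
    by (rule M1.riemannian_metric_zero_left[OF metric1 p(2) that])
  show "g2 z (\<lambda>_. 0) w'' = 0" if "w'' \<in> tangent M2 z"
    by (rule M2.riemannian_metric_zero_left[OF metric2 p(3) that])
  show "g0 x w (\<lambda>_. 0) = 0" if "w \<in> tangent M0 x"
    using 0[OF that] riemannian_metric_sym[OF metric0 p(1) that M0.zero_tangent[OF p(1)]] by simp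
  show "g1 y w' (\<lambda>_. 0) = 0" if "w' \<in> tangent M1 y"
    using 1[OF that] riemannian_metric_sym[OF metric1 p(2) that M1.zero_tangent[OF p(2)]] by simp
qed

lemmas at_zero = M0.coord_vec_zero[OF c(1)] M1.coord_vec_zero[OF c(2)] M2.coord_vec_zero[OF c(3)]
  zero_metrics M0.zero_tangent[OF M0.charts_at_points[OF c(1)]]
  M1.zero_tangent[OF M1.charts_at_points[OF c(2)]] M2.zero_tangent[OF M2.charts_at_points[OF c(3)]]

lemma metric_d1_chart:
  "v \<in> tangent M1 y \<Longrightarrow> w \<in> tangent M1 y \<Longrightarrow> g (F (x, y, z)) (d1 x y z v) (d1 x y z w) = (f1 x)\<^sup>2 * g1 y v w"
  by (simp add: d1_eq metric_dF at_zero M1.coord_vec_tangent_eq[OF _ c(2)])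

lemma metric_d2_chart:
  "v \<in> tangent M2 z \<Longrightarrow> w \<in> tangent M2 z \<Longrightarrow> g (F (x, y, z)) (d2 x y z v) (d2 x y z w) = (f2 x)\<^sup>2 * g2 z v w"
  by (simp add: d2_eq metric_dF at_zero M2.coord_vec_tangent_eq[OF _ c(3)])

lemma metric_d1_d0_chart:
  "v \<in> tangent M1 y \<Longrightarrow> u \<in> tangent M0 x \<Longrightarrow> g (F (x, y, z)) (d1 x y z v) (d0 x y z u) = 0"
  by (simp add: d1_eq d0_eq metric_dF at_zero M0.coord_vec_tangent_eq[OF _ c(1)] M1.coord_vec_tangent_eq[OF _ c(2)])

lemma d_tangent_chart:
  "u \<in> tangent M0 x \<Longrightarrow> d0 x y z u \<in> tangent M (F (x, y, z))"
  "v \<in> tangent M1 y \<Longrightarrow> d1 x y z v \<in> tangent M (F (x, y, z))"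
  "w \<in> tangent M2 z \<Longrightarrow> d2 x y z w \<in> tangent M (F (x, y, z))"
  by (simp_all add: d0_eq d1_eq d2_eq dF_tangent)

end

lemma charts_obtain:
  assumes "x \<in> points M0" "y \<in> points M1" "z \<in> points M2"
  obtains c0 c1 c2 where "c0 \<in> charts_at M0 x" "c1 \<in> charts_at M1 y" "c2 \<in> charts_at M2 z"
  using M0.some_chart_at M1.some_chart_at M2.some_chart_at assms by blast

context
  fixes x y z
  assumes p: "x \<in> points M0" "y \<in> points M1" "z \<in> points M2"
begin

lemma F_point: "F (x, y, z) \<in> points M"
  by (rule charts_obtain[OF p]) (rule F_points)

lemma metric_d1:
  "v \<in> tangent M1 y \<Longrightarrow> w \<in> tangent M1 y \<Longrightarrow> g (F (x, y, z)) (d1 x y z v) (d1 x y z w) = (f1 x)\<^sup>2 * g1 y v w"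
  by (rule charts_obtain[OF p]) (rule metric_d1_chart)

lemma metric_d2:
  "v \<in> tangent M2 z \<Longrightarrow> w \<in> tangent M2 z \<Longrightarrow> g (F (x, y, z)) (d2 x y z v) (d2 x y z w) = (f2 x)\<^sup>2 * g2 z v w"
  by (rule charts_obtain[OF p]) (rule metric_d2_chart)

lemma metric_d1_d0:
  "v \<in> tangent M1 y \<Longrightarrow> u \<in> tangent M0 x \<Longrightarrow> g (F (x, y, z)) (d1 x y z v) (d0 x y z u) = 0"
  by (rule charts_obtain[OF p]) (rule metric_d1_d0_chart)

lemma d0_tangent: "u \<in> tangent M0 x \<Longrightarrow> d0 x y z u \<in> tangent M (F (x, y, z))"
  by (rule charts_obtain[OF p]) (rule d_tangent_chart(1))

lemma d1_tangent: "v \<in> tangent M1 y \<Longrightarrow> d1 x y z v \<in> tangent M (F (x, y, z))"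
  by (rule charts_obtain[OF p]) (rule d_tangent_chart(2))

lemma d2_tangent: "w \<in> tangent M2 z \<Longrightarrow> d2 x y z w \<in> tangent M (F (x, y, z))"
  by (rule charts_obtain[OF p]) (rule d_tangent_chart(3))

end

text \<open>\<open>pullback_form_derivative_zero\<close> on the coordinate fields
  \<open>(a, 0)\<close>, \<open>(0, B)\<close> and \<open>(0, C)\<close>. The fibre charts
  \<open>c1\<close>, \<open>c2\<close> stay fixed while \<open>c0\<close> follows the base point.
  Orthogonality is required throughout the fibre charts because the exterior derivative also
  differentiates along the fibres.\<close>

lemma form_constant_along_base:
  assumes conn: "connected_space (mtop M0)"
    and c12: "c1 \<in> charts_at M1 y" "c2 \<in> charts_at M2 z"
    and \<phi>: "\<And>c0 x. c0 \<in> charts_at M0 x \<Longrightarrow>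
      \<phi> x = form (F (x, y, z)) (dF (x, y, z) c0 c1 c2 (0, B)) (dF (x, y, z) c0 c1 c2 (0, C))"
    and orth: "\<And>c0 x y z a V. V \<in> {B, C} \<Longrightarrow> c0 \<in> charts_at M0 x \<Longrightarrow> c1 \<in> charts_at M1 y \<Longrightarrow>
      c2 \<in> charts_at M2 z \<Longrightarrow>
      form (F (x, y, z)) (dF (x, y, z) c0 c1 c2 (a, 0)) (dF (x, y, z) c0 c1 c2 (0, V)) = 0"
  shows "\<phi> constant_on points M0"
proof (rule connected_zero_derivative_constant[OF smooth0 conn])
  fix c0 x assume c0: "c0 \<in> charts_at M0 x"
  let ?c = "chart3 c0 c1 c2" and ?p = "(x, y, z)"
  note cp = chart3_at[OF c0 c12]
  have atl: "c0 \<in> atlas M0" "c1 \<in> atlas M1" "c2 \<in> atlas M2" "x \<in> cdom c0" "y \<in> cdom c1" "z \<in> cdom c2"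
    using c0 c12 by (auto simp: charts_at_def)
  define \<omega> where "\<omega> = (\<lambda>\<xi>. form (F (cinv ?c \<xi>)) (dF (cinv ?c \<xi>) c0 c1 c2 (0, B)) (dF (cinv ?c \<xi>) c0 c1 c2 (0, C)))"
  have orth': "form (F q) (dF q c0 c1 c2 (a, 0)) (dF q c0 c1 c2 (0, V)) = 0"
    if q: "q \<in> cdom ?c" and V: "V \<in> {B, C}" for q a V
  proof -
    obtain x' y' z' where [simp]: "q = (x', y', z')" by (cases q) auto
    have "c0 \<in> charts_at M0 x'" "c1 \<in> charts_at M1 y'" "c2 \<in> charts_at M2 z'"
      using q atl by (auto simp: cdom_chart3 charts_at_def)
    then show ?thesis using orth[OF V] by simp
  qed
  \<comment> \<open>Differentiability of \<open>\<omega>\<close> does not refer to the direction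
    \<open>a\<close>; \<open>(0, 0)\<close> is merely one of the admissible base directions.\<close>
  have dif: "\<omega> differentiable (at (cmap ?c ?p))"
    unfolding \<omega>_def dF_def
    by (rule pullback_form_derivative_zero(1)[OF P.charted_space_axioms smooth_F cp, where a = "(0, 0)"])
      (use orth' in \<open>auto simp: dF_def\<close>)
  have zero: "fd \<omega> (cmap ?c ?p) (a, 0) = 0" for a
    unfolding \<omega>_def dF_def
    by (rule pullback_form_derivative_zero(2)[OF P.charted_space_axioms smooth_F cp])
      (use orth' in \<open>auto simp: dF_def\<close>)
  \<comment> \<open>Restriction to the slice with the fibre coordinates of \<open>y\<close> and
    \<open>z\<close> held fixed; only base directions \<open>(a, 0)\<close> survive.\<close>
  have "((\<lambda>\<xi>. \<omega> (\<xi>, cmap c1 y, cmap c2 z)) has_derivative (\<lambda>a. fd \<omega> (cmap c0 x, cmap c1 y, cmap c2 z) (a, 0)))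
      (at (cmap c0 x))"
    by (rule has_derivative_fd_compose[where G = "\<lambda>\<xi>. (\<xi>, cmap c1 y, cmap c2 z)"])
      (use dif in \<open>auto simp: cmap_chart3 zero_prod_def intro!: derivative_eq_intros\<close>)
  then have "((\<lambda>\<xi>. \<omega> (\<xi>, cmap c1 y, cmap c2 z)) has_derivative (\<lambda>_. 0)) (at (cmap c0 x))"
    using zero by (simp add: cmap_chart3)
  then show "((\<phi> \<circ> cinv c0) has_derivative (\<lambda>_. 0)) (at (cmap c0 x))"
  proof (rule has_derivative_transform_within_open[OF _ M0.open_chart_image[OF atl(1)]])
    show "cmap c0 x \<in> cmap c0 ` cdom c0" using atl by blast
    fix \<xi> assume "\<xi> \<in> cmap c0 ` cdom c0"
    then obtain x' where x': "x' \<in> cdom c0" "\<xi> = cmap c0 x'" by blast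
    have inv: "cinv ?c (\<xi>, cmap c1 y, cmap c2 z) = (x', y, z)" "cinv c0 \<xi> = x'"
      using cinv_chart3[OF atl(1-3)] x' atl M0.cinv_cmap[OF atl(1)] M1.cinv_cmap[OF atl(2)]
        M2.cinv_cmap[OF atl(3)] by auto
    have "c0 \<in> charts_at M0 x'" using x' atl by (simp add: charts_at_def)
    then show "\<omega> (\<xi>, cmap c1 y, cmap c2 z) = (\<phi> \<circ> cinv c0) \<xi>"
      using \<phi> by (simp add: \<omega>_def inv)
  qed
qed

text \<open>The vectors \<open>v\<close> and \<open>w\<close> live at the single point
  \<open>y\<close>; their coordinates in \<open>c1\<close> extend them to coordinate fields, and it
  is to these extensions that the orthogonality at all points is applied.\<close>

lemma form_d1_constant:
  assumes conn: "connected_space (mtop M0)" and yz: "y \<in> points M1" "z \<in> points M2"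
    and vw: "v \<in> tangent M1 y" "w \<in> tangent M1 y"
    and orth: "\<And>x y z u v. x \<in> points M0 \<Longrightarrow> y \<in> points M1 \<Longrightarrow> z \<in> points M2 \<Longrightarrow>
      u \<in> tangent M0 x \<Longrightarrow> v \<in> tangent M1 y \<Longrightarrow> form (F (x, y, z)) (d0 x y z u) (d1 x y z v) = 0"
  shows "(\<lambda>x. form (F (x, y, z)) (d1 x y z v) (d1 x y z w)) constant_on points M0"
proof -
  obtain c1 c2 where c: "c1 \<in> charts_at M1 y" "c2 \<in> charts_at M2 z"
    using M1.some_chart_at M2.some_chart_at yz by blast
  show ?thesis
  proof (rule form_constant_along_base[OF conn c, where B = "(v c1, 0)" and C = "(w c1, 0)"])
    show "form (F (x, y, z)) (d1 x y z v) (d1 x y z w)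
        = form (F (x, y, z)) (dF (x, y, z) c0 c1 c2 (0, v c1, 0)) (dF (x, y, z) c0 c1 c2 (0, w c1, 0))"
      if "c0 \<in> charts_at M0 x" for c0 x
      using d1_eq[OF that c] vw by simp
    show "form (F (x, y, z)) (dF (x, y, z) c0 c1 c2 (a, 0)) (dF (x, y, z) c0 c1 c2 (0, V)) = 0"
      if V: "V \<in> {(v c1, 0), (w c1, 0)}"
        and c: "c0 \<in> charts_at M0 x" "c1 \<in> charts_at M1 y" "c2 \<in> charts_at M2 z" for c0 x y z a V
    proof -
      obtain b where b: "V = (b, 0)" using V by blast
      show ?thesis
        using orth[OF M0.charts_at_points[OF c(1)] M1.charts_at_points[OF c(2)] M2.charts_at_points[OF c(3)]
            M0.coord_vec_tangent[OF c(1), of a] M1.coord_vec_tangent[OF c(2), of b]]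
        by (simp add: d0_eq[OF c] d1_eq[OF c] M0.coord_vec_tangent[OF c(1)] M1.coord_vec_tangent[OF c(2)]
            M0.coord_vec_self[OF c(1)] M1.coord_vec_self[OF c(2)] b zero_prod_def)
    qed
  qed
qed

lemma form_d2_constant:
  assumes conn: "connected_space (mtop M0)" and yz: "y \<in> points M1" "z \<in> points M2"
    and vw: "v \<in> tangent M2 z" "w \<in> tangent M2 z"
    and orth: "\<And>x y z u v. x \<in> points M0 \<Longrightarrow> y \<in> points M1 \<Longrightarrow> z \<in> points M2 \<Longrightarrow>
      u \<in> tangent M0 x \<Longrightarrow> v \<in> tangent M2 z \<Longrightarrow> form (F (x, y, z)) (d0 x y z u) (d2 x y z v) = 0"
  shows "(\<lambda>x. form (F (x, y, z)) (d2 x y z v) (d2 x y z w)) constant_on points M0"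
proof -
  obtain c1 c2 where c: "c1 \<in> charts_at M1 y" "c2 \<in> charts_at M2 z"
    using M1.some_chart_at M2.some_chart_at yz by blast
  show ?thesis
  proof (rule form_constant_along_base[OF conn c, where B = "(0, v c2)" and C = "(0, w c2)"])
    show "form (F (x, y, z)) (d2 x y z v) (d2 x y z w)
        = form (F (x, y, z)) (dF (x, y, z) c0 c1 c2 (0, 0, v c2)) (dF (x, y, z) c0 c1 c2 (0, 0, w c2))"
      if "c0 \<in> charts_at M0 x" for c0 x
      using d2_eq[OF that c] vw by simp
    show "form (F (x, y, z)) (dF (x, y, z) c0 c1 c2 (a, 0)) (dF (x, y, z) c0 c1 c2 (0, V)) = 0"
      if V: "V \<in> {(0, v c2), (0, w c2)}"
        and c: "c0 \<in> charts_at M0 x" "c1 \<in> charts_at M1 y" "c2 \<in> charts_at M2 z" for c0 x y z a V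
    proof -
      obtain b where b: "V = (0, b)" using V by blast
      show ?thesis
        using orth[OF M0.charts_at_points[OF c(1)] M1.charts_at_points[OF c(2)] M2.charts_at_points[OF c(3)]
            M0.coord_vec_tangent[OF c(1), of a] M2.coord_vec_tangent[OF c(3), of b]]
        by (simp add: d0_eq[OF c] d2_eq[OF c] M0.coord_vec_tangent[OF c(1)] M2.coord_vec_tangent[OF c(3)]
            M0.coord_vec_self[OF c(1)] M2.coord_vec_self[OF c(3)] b zero_prod_def)
    qed
  qed
qed

section \<open>Constancy of the two warping functions\<close>

lemma warping_pos: "x \<in> points M0 \<Longrightarrow> f1 x > 0" "x \<in> points M0 \<Longrightarrow> f2 x > 0"
  using warping unfolding warping_function_def by blast+

text \<open>Write \<open>w\<close> and \<open>w'\<close> for the vectors of the fibre that represent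
  \<open>Jv\<close> at \<open>x\<close> and \<open>x'\<close>. Invariance of the form on the pair
  \<open>v\<close>, \<open>w\<close> reads
  \<open>(f1 x)\<^sup>2 * g1 y v v = (f1 x')\<^sup>2 * g1 y w' w\<close>. As \<open>w\<close> and
  \<open>w'\<close> are as long as \<open>v\<close>, the right side is at most
  \<open>(f1 x')\<^sup>2 * g1 y v v\<close>; exchanging \<open>x\<close> and \<open>x'\<close> gives
  equality.\<close>

lemma holomorphic_factor_warping_constant:
  assumes conn: "connected_space (mtop M0)"
    and hol: "\<forall>x\<in>points M0. \<forall>z\<in>points M2. holomorphic_submfd M J M1 (\<lambda>y. F (x, y, z))"
  shows "f1 constant_on points M0"
proof -
  have Jd1: "\<exists>w\<in>tangent M1 y. J (F (x, y, z)) (d1 x y z v) = d1 x y z w"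
    if "x \<in> points M0" "y \<in> points M1" "z \<in> points M2" "v \<in> tangent M1 y" for x y z v
    using hol that unfolding holomorphic_submfd_def by blast
  have orth: "form (F (x, y, z)) (d0 x y z u) (d1 x y z v) = 0"
    if p: "x \<in> points M0" "y \<in> points M1" "z \<in> points M2"
      and uv: "u \<in> tangent M0 x" "v \<in> tangent M1 y" for x y z u v
  proof -
    obtain w where w: "w \<in> tangent M1 y" "J (F (x, y, z)) (d1 x y z v) = d1 x y z w"
      using Jd1[OF p uv(2)] by blast
    have "form (F (x, y, z)) (d0 x y z u) (d1 x y z v) = - form (F (x, y, z)) (d1 x y z v) (d0 x y z u)"
      by (rule form_skew[OF F_point[OF p] d0_tangent[OF p uv(1)] d1_tangent[OF p uv(2)]])
    then show ?thesis using metric_d1_d0[OF p w(1) uv(1)] by (simp add: form_def w(2))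
  qed
  obtain y z where yz: "y \<in> points M1" "z \<in> points M2"
    using smooth1 smooth2 unfolding smooth_manifold_def by blast
  obtain v where v: "v \<in> tangent M1 y" "v \<noteq> (\<lambda>_. 0)"
    using M1.exists_nonzero_tangent[OF yz(1)] .
  have G: "g1 y v v > 0" by (rule riemannian_metric_pos[OF metric1 yz(1) v])
  have le: "f1 x \<le> f1 x'" if x: "x \<in> points M0" "x' \<in> points M0" for x x'
  proof -
    have form: "form (F (t, y, z)) (d1 t y z v) (d1 t y z b) = (f1 t)\<^sup>2 * g1 y a b"
      if "t \<in> points M0" "a \<in> tangent M1 y" "b \<in> tangent M1 y" "J (F (t, y, z)) (d1 t y z v) = d1 t y z a"
      for t a b
      using metric_d1[OF that(1) yz that(2,3)] that(4) by (simp add: form_def)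
    \<comment> \<open>\<open>J\<close> preserves \<open>g\<close>, and \<open>g\<close> on the leaf
      over \<open>t\<close> is \<open>g1\<close> times the same factor for both vectors, so lengths
      for \<open>g1\<close> agree as well.\<close>
    have unit: "g1 y a a = g1 y v v"
      if "t \<in> points M0" "a \<in> tangent M1 y" "J (F (t, y, z)) (d1 t y z v) = d1 t y z a" for t a
    proof -
      have "(f1 t)\<^sup>2 * g1 y a a = (f1 t)\<^sup>2 * g1 y v v"
        using J_isometry[OF F_point[OF that(1) yz] d1_tangent[OF that(1) yz v(1)] d1_tangent[OF that(1) yz v(1)]]
          metric_d1[OF that(1) yz that(2,2)] metric_d1[OF that(1) yz v(1) v(1)] that(3) by simp
      then show ?thesis using warping_pos(1)[OF that(1)] by simp
    qed
    obtain w where w: "w \<in> tangent M1 y" "J (F (x, y, z)) (d1 x y z v) = d1 x y z w"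
      using Jd1[OF x(1) yz v(1)] by blast
    obtain w' where w': "w' \<in> tangent M1 y" "J (F (x', y, z)) (d1 x' y z v) = d1 x' y z w'"
      using Jd1[OF x(2) yz v(1)] by blast
    \<comment> \<open>At \<open>x'\<close> the vector \<open>w\<close> need not represent
      \<open>Jv\<close>; it is kept as a test vector so that both sides evaluate the form on the
      same pair.\<close>
    have "form (F (x, y, z)) (d1 x y z v) (d1 x y z w) = form (F (x', y, z)) (d1 x' y z v) (d1 x' y z w)"
      using form_d1_constant[OF conn yz v(1) w(1) orth] x unfolding constant_on_def by auto
    then have "(f1 x)\<^sup>2 * g1 y v v = (f1 x')\<^sup>2 * g1 y w' w"
      using form[OF x(1) w(1) w(1) w(2)] form[OF x(2) w'(1) w(1) w'(2)] unit[OF x(1) w] by simp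
    also have "g1 y w' w \<le> g1 y v v"
      using M1.riemannian_metric_am_gm[OF metric1 yz(1) w'(1) w(1), of 1 1] unit[OF x(1) w] unit[OF x(2) w']
      by simp
    then have "(f1 x')\<^sup>2 * g1 y w' w \<le> (f1 x')\<^sup>2 * g1 y v v" by (intro mult_left_mono) auto
    finally have "(f1 x)\<^sup>2 \<le> (f1 x')\<^sup>2" using G by simp
    then show ?thesis by (rule power2_le_imp_le) (use warping_pos(1)[OF x(2)] in simp)
  qed
  show ?thesis unfolding constant_on_def using le by (meson order_antisym)
qed

text \<open>For fixed \<open>v\<close>, \<open>cos (\<theta> z)\<close> is the least upper bound of
  \<open>r x\<close> over \<open>A\<close> at every base point \<open>x\<close>. The numerator of
  \<open>r\<close> is independent of \<open>x\<close>, so passing from \<open>x\<close> to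
  \<open>x'\<close> multiplies \<open>r\<close> by \<open>l\<close>. The least upper bound is
  unchanged, hence \<open>l = 1\<close> or \<open>cos (\<theta> z) = 0\<close>.\<close>

lemma slant_factor_warping_constant:
  assumes conn: "connected_space (mtop M0)"
    and normal: "base_J_normal M J g M0 M1 M2 F"
    and slant: "\<forall>x\<in>points M0. \<forall>y\<in>points M1. is_slant_function M J g M2 (\<lambda>z. F (x, y, z)) \<theta>"
    and z: "z \<in> points M2" "\<theta> z \<noteq> pi / 2"
  shows "f2 constant_on points M0"
proof -
  have orth: "form (F (x, y, z)) (d0 x y z u) (d2 x y z v) = 0"
    if p: "x \<in> points M0" "y \<in> points M1" "z \<in> points M2"
      and uv: "u \<in> tangent M0 x" "v \<in> tangent M2 z" for x y z u v
  proof -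
    obtain c0 c1 c2 where c: "c0 \<in> charts_at M0 x" "c1 \<in> charts_at M1 y" "c2 \<in> charts_at M2 z"
      using charts_obtain[OF p] .
    show ?thesis
      using normal p uv(1) P.coord_vec_tangent[OF chart3_at[OF c], of "(0, 0, v c2)"]
      unfolding base_J_normal_def form_def d2_eq[OF c uv(2)] dF_def by blast
  qed
  obtain y where y: "y \<in> points M1" using smooth1 unfolding smooth_manifold_def by blast
  obtain v where v: "v \<in> tangent M2 z" "v \<noteq> (\<lambda>_. 0)"
    using M2.exists_nonzero_tangent[OF z(1)] .
  define A where "A = tangent M2 z - {\<lambda>_. 0}"
  \<comment> \<open>The cosine of the angle between \<open>J\<close> of the image of
    \<open>v\<close> and the image of \<open>w\<close>: both lengths pick up a factor
    \<open>f2 x\<close>, hence the square.\<close>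
  define r where "r = (\<lambda>x w. form (F (x, y, z)) (d2 x y z v) (d2 x y z w)
    / ((f2 x)\<^sup>2 * (sqrt (g2 z v v) * sqrt (g2 z w w))))"
  have A: "A \<noteq> {}" using v by (auto simp: A_def)
  have sup: "0 \<le> \<theta> z" "\<theta> z \<le> pi" "\<And>w. w \<in> A \<Longrightarrow> r x w \<le> cos (\<theta> z)"
    "\<And>s. (\<And>w. w \<in> A \<Longrightarrow> r x w \<le> s) \<Longrightarrow> cos (\<theta> z) \<le> s" if x: "x \<in> points M0" for x
  proof -
    let ?q = "F (x, y, z)"
    note p = x y z(1)
    note tan = d2_tangent[OF p]
    have pos: "f2 x > 0" by (rule warping_pos(2)[OF x])
    have len: "sqrt (g ?q (d2 x y z w) (d2 x y z w)) = f2 x * sqrt (g2 z w w)" if "w \<in> tangent M2 z" for w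
      using metric_d2[OF p that that] pos by (simp add: real_sqrt_mult)
    have lenJ: "sqrt (g ?q (J ?q (d2 x y z v)) (J ?q (d2 x y z v))) = f2 x * sqrt (g2 z v v)"
      using len[OF v(1)] J_isometry[OF F_point[OF p] tan[OF v(1)] tan[OF v(1)]] by simp
    have r: "g ?q (J ?q (d2 x y z v)) (d2 x y z w) /
        (sqrt (g ?q (J ?q (d2 x y z v)) (J ?q (d2 x y z v))) * sqrt (g ?q (d2 x y z w) (d2 x y z w))) = r x w"
      if "w \<in> tangent M2 z" for w
      unfolding len[OF that] lenJ by (simp add: r_def form_def power2_eq_square mult_ac)
    \<comment> \<open>The infimum in \<open>angle_to\<close> runs over nonzero vectors of an image
      that depends on \<open>x\<close>; this equivalence reindexes it by the fixed set
      \<open>A\<close>.\<close>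
    have zero_iff: "d2 x y z w = (\<lambda>_. 0) \<longleftrightarrow> w = (\<lambda>_. 0)" if w: "w \<in> tangent M2 z" for w
    proof
      assume "d2 x y z w = (\<lambda>_. 0)"
      then have "(f2 x)\<^sup>2 * g2 z w w = 0"
        using metric_d2[OF p w w] riemannian_metric_zero_left[OF metric F_point[OF p] tan[OF w]] by simp
      then show "w = (\<lambda>_. 0)"
        using riemannian_metric_pos[OF metric2 z(1) w] pos by force
    next
      assume "w = (\<lambda>_. 0)"
      then have "g ?q (d2 x y z w) (d2 x y z w) = 0"
        using metric_d2[OF p w w] M2.riemannian_metric_zero_left[OF metric2 z(1) w] by simp
      then show "d2 x y z w = (\<lambda>_. 0)"
        using riemannian_metric_pos[OF metric F_point[OF p] tan[OF w]] by force
    qed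
    have img: "d2 x y z ` tangent M2 z - {\<lambda>_. 0} = d2 x y z ` A"
      using zero_iff by (auto simp: A_def)
    have angle: "angle_to g ?q (J ?q (d2 x y z v)) (d2 x y z ` tangent M2 z) = \<theta> z"
      using slant x y z(1) v unfolding is_slant_function_def by blast
    have "\<theta> z = (INF w\<in>A. arccos (r x w))"
      unfolding angle[symmetric] angle_to_def img image_image
      by (intro arg_cong[where f = Inf] image_cong refl arg_cong[where f = arccos] r) (simp add: A_def)
    moreover have "\<bar>r x w\<bar> \<le> 1" if "w \<in> A" for w
    proof -
      have w: "w \<in> tangent M2 z" "w \<noteq> (\<lambda>_. 0)" using that by (auto simp: A_def)
      have "\<bar>g ?q (J ?q (d2 x y z v)) (d2 x y z w)\<bar>
        \<le> sqrt (g ?q (J ?q (d2 x y z v)) (J ?q (d2 x y z v))) * sqrt (g ?q (d2 x y z w) (d2 x y z w))"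
        by (rule riemannian_metric_cauchy_schwarz[OF metric F_point[OF p]
              J_tangent[OF F_point[OF p] tan[OF v(1)]] tan[OF w(1)]])
      moreover have "sqrt (g ?q (J ?q (d2 x y z v)) (J ?q (d2 x y z v))) * sqrt (g ?q (d2 x y z w) (d2 x y z w)) > 0"
        unfolding len[OF w(1)] lenJ using pos riemannian_metric_pos[OF metric2 z(1) v]
          riemannian_metric_pos[OF metric2 z(1) w] by simp
      ultimately show ?thesis unfolding r[OF w(1), symmetric]
        by (simp only: abs_divide abs_of_pos divide_le_eq_1_pos)
    qed
    ultimately show "0 \<le> \<theta> z" "\<theta> z \<le> pi" "\<And>w. w \<in> A \<Longrightarrow> r x w \<le> cos (\<theta> z)"
      "\<And>s. (\<And>w. w \<in> A \<Longrightarrow> r x w \<le> s) \<Longrightarrow> cos (\<theta> z) \<le> s"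
      using cos_INF_arccos[OF A, of "r x" "\<theta> z"] by blast+
  qed
  have "f2 x = f2 x'" if x: "x \<in> points M0" "x' \<in> points M0" for x x'
  proof (rule ccontr)
    assume ne: "f2 x \<noteq> f2 x'"
    define l where "l = (f2 x)\<^sup>2 / (f2 x')\<^sup>2"
    have pos: "f2 x > 0" "f2 x' > 0" using warping_pos(2) x by blast+
    then have l: "l > 0" "l \<noteq> 1"
      using ne by (auto simp: l_def power2_eq_iff_nonneg)
    have scale: "r x' w = l * r x w" if "w \<in> A" for w
    proof -
      have "w \<in> tangent M2 z" using that by (simp add: A_def)
      then obtain k where "\<forall>t\<in>points M0. form (F (t, y, z)) (d2 t y z v) (d2 t y z w) = k"
        using form_d2_constant[OF conn y z(1) v(1) _ orth] unfolding constant_on_def by blast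
      then have "form (F (x, y, z)) (d2 x y z v) (d2 x y z w) = form (F (x', y, z)) (d2 x' y z v) (d2 x' y z w)"
        using x by simp
      then show ?thesis using pos by (simp add: r_def l_def)
    qed
    \<comment> \<open>Leastness of the bound is used at \<open>x'\<close> and then at
      \<open>x\<close>; the two inequalities are opposite, whatever the sign of the cosine.\<close>
    have "cos (\<theta> z) \<le> l * cos (\<theta> z)"
      by (rule sup(4)[OF x(2)]) (use scale sup(3)[OF x(1)] l in simp)
    moreover have "cos (\<theta> z) \<le> cos (\<theta> z) / l"
      by (rule sup(4)[OF x(1)]) (use scale sup(3)[OF x(2)] l in \<open>simp add: field_simps\<close>)
    ultimately have "cos (\<theta> z) = l * cos (\<theta> z)" using l by (simp add: field_simps)
    then have "cos (\<theta> z) = 0" using l by simp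
    then have "\<theta> z = pi / 2" using arccos_cos[OF sup(1,2)[OF x(1)]] by (simp add: arccos_0)
    then show False using z(2) by simp
  qed
  then show ?thesis unfolding constant_on_def by blast
qed

end

text \<open>Slantness of the single leaves would allow a slant function for each of them; comparing
  base points calls for one \<open>\<theta>\<close> common to all. Where \<open>\<theta>\<close> is
  \<open>pi / 2\<close> the form vanishes on the slant fibre and its invariance says nothing about
  \<open>\<sigma>\<close>, hence the condition that another value occurs.\<close>

theorem corollary4p1:
  fixes M :: "('m, 'k::euclidean_space) mfd" and J :: "('m, 'k) endo" and g :: "('m, 'k) metric"
    and Mperp :: "('a, 'e::euclidean_space) mfd" and g0 :: "('a, 'e) metric"
    and MT :: "('b, 'f::euclidean_space) mfd" and g1 :: "('b, 'f) metric"
    and Mth :: "('c, 'h::euclidean_space) mfd" and g2 :: "('c, 'h) metric"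
    and f \<sigma> :: "'a \<Rightarrow> real" and F :: "'a \<times> 'b \<times> 'c \<Rightarrow> 'm"
  assumes "kaehler_manifold M J g"
    and "biwarped_submanifold M g Mperp g0 f MT g1 \<sigma> Mth g2 F"
    and "connected_space (mtop Mperp)"
    and "\<forall>y\<in>points MT. \<forall>z\<in>points Mth. totally_real M J g Mperp (\<lambda>x. F (x, y, z))"
    and "\<forall>x\<in>points Mperp. \<forall>z\<in>points Mth. holomorphic_submfd M J MT (\<lambda>y. F (x, y, z))"
    and "\<forall>x\<in>points Mperp. \<forall>y\<in>points MT.
           pointwise_slant M J g Mth (\<lambda>z. F (x, y, z)) \<or> slant M J g Mth (\<lambda>z. F (x, y, z))"
  shows "f constant_on points Mperp \<and>
         (base_J_normal M J g Mperp MT Mth F \<and>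
          (\<exists>\<theta>. (\<forall>x\<in>points Mperp. \<forall>y\<in>points MT.
                   is_slant_function M J g Mth (\<lambda>z. F (x, y, z)) \<theta>) \<and>
                (\<exists>z\<in>points Mth. \<theta> z \<noteq> pi / 2))
          \<longrightarrow> trivial_biwarped Mperp f \<sigma>)"
proof -
  interpret biwarped_kaehler_submanifold M J g Mperp g0 f MT g1 \<sigma> Mth g2 F
    by unfold_locales (rule assms)+
  have "f constant_on points Mperp"
    by (rule holomorphic_factor_warping_constant[OF assms(3,5)])
  moreover have "\<sigma> constant_on points Mperp"
    if "base_J_normal M J g Mperp MT Mth F"
      "\<forall>x\<in>points Mperp. \<forall>y\<in>points MT. is_slant_function M J g Mth (\<lambda>z. F (x, y, z)) \<theta>"
      "z \<in> points Mth" "\<theta> z \<noteq> pi / 2" for \<theta> z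
    by (rule slant_factor_warping_constant[OF assms(3) that])
  ultimately show ?thesis unfolding trivial_biwarped_def by blast
qed

end
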